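(* Let $\alpha>0$, $\beta\in\mathbb{R}$, $c\in\mathbb{R}$, and let $f$ be a meromorphic function on $\mathbb{H}_c=\{z\in\mathbb{C}:\Re(z)>c\}$ satisfying the following conditions. (1) There exist $K>0$ and $c'>c$ such that $|f(\sigma+it)|\le K$ for all $\sigma>c'$ and all $t\in\mathbb{R}$. (2) There exists a non-increasing function $\nu:(c,\infty)\to\mathbb{R}$ such that $\nu(\sigma)\le1+c-\sigma$ whenever $\sigma$ is sufficiently near $c$, and such that for any $\epsilon>0$ we have $f(\sigma+it)\ll_{f,\epsilon}|t|^{\nu(\sigma)+\epsilon}$ as $|t|\to\infty$. (3) $f$ has at most one pole in $\mathbb{H}_c$; if there is one, it is located at $s_0=\sigma_0+it_0$ and has order $m\ge1$ (put $m=0$ if $f$ has no pole in $\mathbb{H}_c$). If $(n_l,k_l)_{l\ge1}$ is a Stoltz sequence, then for any $s\in\mathbb{H}_c$ with $\Re(s)\ne\sigma_0$ (any $s\in\mathbb{H}_c$ if $f$ has no pole) we have $$\lim_{l\to\infty}\frac1{k_l}\sum_{j=1}^{k_l}f\bigl(s+iT_{\alpha,\beta}^{n_l+j}(x)\bigr)=\frac{\alpha}{\pi}\int_{\mathbb{R}}\frac{f(s+i\tau)}{\alpha^2+(\tau-\beta)^2}\,d\tau$$ for (Lebesgue) almost all $x\in\mathbb{R}$.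
   Context: For $\alpha>0$ and $\beta\in\mathbb{R}$, $T_{\alpha,\beta}:\mathbb{R}\to\mathbb{R}$ is the map $T_{\alpha,\beta}(x)=\frac{\alpha}{2}\left(\frac{x+\beta}{\alpha}-\frac{\alpha}{x-\beta}\right)$ if $x\ne\beta$, and $T_{\alpha,\beta}(\beta)=\beta$; $T_{\alpha,\beta}^{j}$ denotes its $j$-th iterate. It preserves, and is ergodic for, the probability measure $\mu_{\alpha,\beta}(A)=\frac{\alpha}{\pi}\int_A\frac{dt}{\alpha^2+(t-\beta)^2}$. Stoltz sequences. For a set $Z\subseteq\mathbb{Z}\times\mathbb{N}$, put $Z^h=\{(n,k)\in Z:k\ge h\}$, $Z^h_{\alpha}=\{(z,s)\in\mathbb{Z}^2:|z-y|<\alpha(s-r)\text{ for some }(y,r)\in Z^h\}$, and $Z^h_{\alpha}(\lambda)=\{n:(n,\lambda)\in Z^h_{\alpha}\}$ for $\lambda\in\mathbb{N}$. A sequence of pairs of natural numbers $(n_l,k_l)_{l\ge1}$ is Stoltz if there exist a set $Z\subseteq\mathbb{Z}\times\mathbb{N}$ and a function $h=h(t)$ tending to infinity with $t$ such that $(n_l,k_l)\in Z^{h(t)}$ for all $l\ge t$, and there exist $h_0$, $\alpha_0>0$ and $A>0$ such that $|Z^{h_0}_{\alpha_0}(\lambda)|\le A\lambda$ for all integers $\lambda>0$. *)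

theory Defs
  imports "HOL-Complex_Analysis.Complex_Analysis"
begin

definition right_halfplane :: "real \<Rightarrow> complex set" where
  "right_halfplane c = {z. c < Re z}"

definition poles_in :: "complex set \<Rightarrow> (complex \<Rightarrow> complex) \<Rightarrow> complex set" where
  "poles_in S f = {z \<in> S. is_pole f z}"

text \<open>
  Meromorphic functions are total functions here. The library predicate \<open>meromorphic_on\<close> only
  controls a function up to its values at isolated points, so holomorphy off the poles is required
  in addition; the value at a pole remains arbitrary.
\<close>

definition meromorphic_function_on :: "(complex \<Rightarrow> complex) \<Rightarrow> complex set \<Rightarrow> bool" where
  "meromorphic_function_on f S \<longleftrightarrow>
     f meromorphic_on S \<and> f holomorphic_on (S - poles_in S f)"

definition boole_map :: "real \<Rightarrow> real \<Rightarrow> real \<Rightarrow> real" where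
  "boole_map \<alpha> \<beta> x =
     (if x = \<beta> then \<beta> else \<alpha> / 2 * ((x + \<beta>) / \<alpha> - \<alpha> / (x - \<beta>)))"

definition upper_part :: "(int \<times> nat) set \<Rightarrow> real \<Rightarrow> (int \<times> nat) set" where
  "upper_part Z h = {(n, k) \<in> Z. real k \<ge> h}"

definition cone_region :: "(int \<times> nat) set \<Rightarrow> real \<Rightarrow> real \<Rightarrow> (int \<times> int) set" where
  "cone_region Z h a =
     {(z, s). \<exists>(y, r) \<in> upper_part Z h. \<bar>real_of_int (z - y)\<bar> < a * real_of_int (s - int r)}"

definition cone_section :: "(int \<times> nat) set \<Rightarrow> real \<Rightarrow> real \<Rightarrow> nat \<Rightarrow> int set" where
  "cone_section Z h a l = {n. (n, int l) \<in> cone_region Z h a}"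

text \<open>
  Sequences are indexed from 1, so the values \<open>n 0\<close> and \<open>k 0\<close> play no role. Finiteness of the
  sections is part of the cardinality bound and is stated because \<open>card\<close> is 0 on infinite sets.
\<close>

definition stoltz :: "(nat \<Rightarrow> nat) \<Rightarrow> (nat \<Rightarrow> nat) \<Rightarrow> bool" where
  "stoltz n k \<longleftrightarrow>
     (\<exists>Z :: (int \<times> nat) set.
        (\<exists>h :: nat \<Rightarrow> real. filterlim h at_top at_top \<and>
           (\<forall>t\<ge>1. \<forall>l\<ge>t. (int (n l), k l) \<in> upper_part Z (h t))) \<and>
        (\<exists>h0 a0 A :: real. a0 > 0 \<and> A > 0 \<and>
           (\<forall>l>0. finite (cone_section Z h0 a0 l) \<and>
                  real (card (cone_section Z h0 a0 l)) \<le> A * real l)))"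

end

theory Submission
  imports Defs "HOL-Probability.Probability" "HOL-Real_Asymp.Real_Asymp"
begin

text \<open>
  A Vitali covering argument on the integers turns the cone condition into a weak type (1,1) bound
  for the moving maximal function, and transference carries it over to every measure-preserving map.
  Hence the integrable functions whose moving averages converge to their integral form an
  \<open>L\<^sup>1\<close>-closed subspace, and it suffices to treat a dense class.

  The coordinate \<open>w(x) = (x - \<beta> + i\<alpha>) / (x - \<beta> - i\<alpha>)\<close> conjugates the Boole map to the squaring map of the
  unit circle and the Cauchy measure to Haar measure. The Birkhoff means of a nontrivial character
  \<open>w\<^sup>m\<close> are lacunary sums of orthonormal functions, so they tend to 0 in \<open>L\<^sup>2\<close>, and the difference of
  \<open>w\<^sup>m\<close> and such a mean is a bounded coboundary, whose moving averages tend to 0 trivially. Characters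
  span a dense subspace by the Stone-Weierstrass theorem. Finally the growth exponent on the line
  \<open>Re z = Re s\<close> is less than 1, so \<open>\<tau> \<mapsto> f(s + i\<tau>)\<close> is continuous and integrable for the Cauchy measure.
\<close>

subsection \<open>A covering bound for Stoltz sequences\<close>

text \<open>Greedy choice: a longest interval is selected, all intervals meeting it are discarded,
  and the rest is handled by induction. Positive lengths make the selected interval meet itself, so
  the family really shrinks.\<close>

lemma finite_vitali_intervals:
  fixes a b :: "'i \<Rightarrow> nat"
  assumes "finite S" and "\<And>i. i \<in> S \<Longrightarrow> b i > 0"
  shows "\<exists>D\<subseteq>S. disjoint_family_on (\<lambda>i. {a i<..a i + b i}) D \<and>
      (\<forall>i\<in>S. \<exists>d\<in>D. b i \<le> b d \<and> {a i<..a i + b i} \<inter> {a d<..a d + b d} \<noteq> {})"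
  using assms
proof (induction S rule: finite_psubset_induct)
  case (psubset S)
  define I where "I i = {a i<..a i + b i}" for i
  have "\<exists>D\<subseteq>S. disjoint_family_on I D \<and> (\<forall>i\<in>S. \<exists>d\<in>D. b i \<le> b d \<and> I i \<inter> I d \<noteq> {})"
  proof (cases "S = {}")
    case False
    have "Max (b ` S) \<in> b ` S"
      using False psubset.hyps by (intro Max_in) auto
    then obtain i0 where i0: "i0 \<in> S" "b i0 = Max (b ` S)"
      by auto
    have mx: "b i \<le> b i0" if "i \<in> S" for i
      using i0(2) that psubset.hyps by simp
    have ne: "I i0 \<inter> I i0 \<noteq> {}"
      using psubset.prems[OF i0(1)] by (auto simp: I_def)
    define S' where "S' = {i\<in>S. I i \<inter> I i0 = {}}"
    have "S' \<subset> S"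
      using i0(1) ne unfolding S'_def by blast
    moreover have "\<And>i. i \<in> S' \<Longrightarrow> b i > 0"
      using psubset.prems by (auto simp: S'_def)
    ultimately obtain D where D: "D \<subseteq> S'" "disjoint_family_on I D"
      "\<forall>i\<in>S'. \<exists>d\<in>D. b i \<le> b d \<and> I i \<inter> I d \<noteq> {}"
      using psubset.IH[of S'] unfolding I_def by blast
    have "disjoint_family_on I (insert i0 D)"
      using D(1,2) unfolding disjoint_family_on_def S'_def by blast
    moreover have "insert i0 D \<subseteq> S"
      using D(1) i0(1) by (auto simp: S'_def)
    moreover have "\<exists>d\<in>insert i0 D. b i \<le> b d \<and> I i \<inter> I d \<noteq> {}" if "i \<in> S" for i
      using D(3) mx[OF that] that by (cases "i \<in> S'") (auto simp: S'_def)
    ultimately show ?thesis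
      by (intro exI[of _ "insert i0 D"]) blast
  qed (simp add: disjoint_family_on_def)
  then show ?case
    unfolding I_def .
qed

text \<open>This is the weak type (1,1) bound on the integers, \<open>E\<close> being a set of
  points where some moving average of \<open>g\<close> exceeds \<open>lam\<close>. The Vitali
  selection charges each point of \<open>E\<close> to one of several disjoint intervals, at least as
  long as its own, and the cone condition limits the number of points charged to one interval to a
  multiple of its length.\<close>

lemma stoltz_card_bound:
  fixes Z :: "(int \<times> nat) set" and n k :: "nat \<Rightarrow> nat" and g :: "nat \<Rightarrow> real"
  assumes a: "a > 0" and A: "A > 0"
    and sec: "\<And>l. l > 0 \<Longrightarrow> finite (cone_section Z hm a l) \<and>
                  real (card (cone_section Z hm a l)) \<le> A * real l"
    and E: "finite E"
    and L: "\<And>z. z \<in> E \<Longrightarrow> (int (n (L z)), k (L z)) \<in> upper_part Z hm \<and> k (L z) > 0"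
    and avg: "\<And>z. z \<in> E \<Longrightarrow> (\<Sum>j=1..k (L z). g (z + n (L z) + j)) > lam * real (k (L z))"
    and M: "\<And>z. z \<in> E \<Longrightarrow> z + n (L z) + k (L z) < M"
    and g: "\<And>i. g i \<ge> 0" and lam: "lam > 0"
  shows "lam * real (card E) \<le> A * (2 + 1 / a) * (\<Sum>i<M. g i)"
proof -
  define N where "N z = z + n (L z)" for z
  define K where "K z = k (L z)" for z
  define I where "I z = {N z<..N z + K z}" for z
  let ?B = "A * (2 + 1 / a)"
  have K: "K z > 0" if "z \<in> E" for z
    using L that by (simp add: K_def)
  have "\<exists>D\<subseteq>E. disjoint_family_on I D \<and> (\<forall>i\<in>E. \<exists>d\<in>D. K i \<le> K d \<and> I i \<inter> I d \<noteq> {})"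
    unfolding I_def by (rule finite_vitali_intervals[OF E K])
  then obtain D where D: "D \<subseteq> E" "disjoint_family_on I D"
    "\<forall>i\<in>E. \<exists>d\<in>D. K i \<le> K d \<and> I i \<inter> I d \<noteq> {}"
    by blast
  have finD: "finite D"
    using D(1) E finite_subset by blast
  define F where "F d = {z\<in>E. K z \<le> K d \<and> I z \<inter> I d \<noteq> {}}" for d
  have F: "real (card (F d)) \<le> ?B * real (K d)" if d: "d \<in> D" for d
  proof -
    \<comment> \<open>At height \<open>s\<close> the cone over a point of height
      \<open>K z \<le> K d\<close> has half-width at least \<open>K d\<close>, since
      \<open>a * (s - K d) \<ge> K d\<close>. Rounding up costs at most 1, which
      \<open>K d \<ge> 1\<close> absorbs; this turns \<open>1 + 1 / a\<close> into
      \<open>2 + 1 / a\<close>.\<close>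
    define s where "s = nat \<lceil>real (K d) * (1 + 1 / a)\<rceil>"
    have Kd: "K d > 0"
      using K D(1) d by auto
    have s1: "real (K d) * (1 + 1 / a) \<le> real s"
      unfolding s_def by (rule real_nat_ceiling_ge)
    have "real (K d) * (1 + 1 / a) > 0"
      using Kd a by (simp add: add_pos_pos)
    then have s2: "real s \<le> real (K d) * (1 + 1 / a) + 1" and s0: "s > 0"
      unfolding s_def by linarith+
    \<comment> \<open>The reflection brings all charged points into a single section:
      \<open>N d - z\<close> differs from \<open>n (L z)\<close>, the first coordinate of a point of
      \<open>Z\<close>, by \<open>N d - N z\<close>, which is below \<open>K d\<close> in absolute
      value because the two intervals meet.\<close>
    have "(\<lambda>z. int (N d) - int z) ` F d \<subseteq> cone_section Z hm a s"
    proof (intro image_subsetI)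
      fix z assume z: "z \<in> F d"
      then have zE: "z \<in> E" and Kz: "K z \<le> K d" and ne: "I z \<inter> I d \<noteq> {}"
        by (auto simp: F_def)
      from ne obtain p where "p \<in> I z" "p \<in> I d"
        by blast
      with Kz have "\<bar>int (N d) - int (N z)\<bar> < int (K d)"
        unfolding I_def greaterThanAtMost_iff by linarith
      then have "\<bar>real_of_int (int (N d) - int (N z))\<bar> < real (K d)"
        by linarith
      also have "real (K d) \<le> a * (real s - real (K z))"
      proof -
        have "real (K d) = a * (real (K d) * (1 + 1 / a) - real (K d))"
          using a by (simp add: field_simps)
        also have "\<dots> \<le> a * (real s - real (K z))"
          using a s1 Kz by (intro mult_left_mono) auto
        finally show ?thesis .
      qed
      finally have "\<bar>real_of_int (int (N d) - int z - int (n (L z)))\<bar>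
          < a * real_of_int (int s - int (K z))"
        by (simp add: N_def algebra_simps)
      then show "int (N d) - int z \<in> cone_section Z hm a s"
        using L[OF zE] by (auto simp: cone_section_def cone_region_def K_def intro!: bexI)
    qed
    moreover have "inj_on (\<lambda>z. int (N d) - int z) (F d)"
      by (auto simp: inj_on_def)
    ultimately have "card (F d) \<le> card (cone_section Z hm a s)"
      using sec[OF s0] card_inj_on_le by blast
    then have "real (card (F d)) \<le> A * real s"
      using sec[OF s0] by linarith
    also have "\<dots> \<le> A * (real (K d) * (1 + 1 / a) + real (K d))"
      using A s2 Kd by (intro mult_left_mono) auto
    also have "\<dots> = ?B * real (K d)"
      by (simp add: algebra_simps)
    finally show ?thesis .
  qed
  have finF: "finite (F d)" for d
    using E by (simp add: F_def)
  have "E \<subseteq> (\<Union>d\<in>D. F d)"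
    using D(3) unfolding F_def by fast
  then have "card E \<le> (\<Sum>d\<in>D. card (F d))"
    using card_mono[of "\<Union>d\<in>D. F d" E] card_UN_le[OF finD, of F] finD finF by force
  then have "lam * real (card E) \<le> lam * (\<Sum>d\<in>D. real (card (F d)))"
    using lam by (simp flip: of_nat_sum)
  also have "\<dots> \<le> lam * (\<Sum>d\<in>D. ?B * real (K d))"
    using lam F by (intro mult_left_mono sum_mono) auto
  also have "\<dots> = ?B * (\<Sum>d\<in>D. lam * real (K d))"
    by (simp add: sum_distrib_left mult_ac)
  also have "(\<Sum>d\<in>D. lam * real (K d)) \<le> (\<Sum>d\<in>D. \<Sum>i\<in>I d. g i)"
  proof (rule sum_mono)
    fix d assume "d \<in> D"
    then have "lam * real (K d) < (\<Sum>j=1..K d. g (N d + j))"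
      using avg D(1) by (auto simp: K_def N_def)
    also have "\<dots> = (\<Sum>i\<in>I d. g i)"
      by (rule sum.reindex_bij_witness[of _ "\<lambda>i. i - N d" "\<lambda>j. N d + j"]) (auto simp: I_def)
    finally show "lam * real (K d) \<le> (\<Sum>i\<in>I d. g i)"
      by simp
  qed
  also have "(\<Sum>d\<in>D. \<Sum>i\<in>I d. g i) = (\<Sum>i\<in>(\<Union>d\<in>D. I d). g i)"
    using D(2) finD by (intro sum.UNION_disjoint[symmetric]) (auto simp: disjoint_family_on_def I_def)
  also have "\<dots> \<le> (\<Sum>i<M. g i)"
  proof (rule sum_mono2)
    show "(\<Union>d\<in>D. I d) \<subseteq> {..<M}"
    proof (intro UN_least subsetI)
      fix d i assume "d \<in> D" "i \<in> I d"
      moreover from this have "N d + K d < M"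
        using M D(1) by (auto simp: K_def N_def)
      ultimately show "i \<in> {..<M}"
        by (simp add: I_def)
    qed
  qed (use g in auto)
  finally show ?thesis
    using A a by (simp add: mult_left_mono)
qed

text \<open>The constant depends on the sequence only. Its uniformity in the finite set, the choice
  of indices, the function and the level is what transference to orbits requires.\<close>

lemma stoltz_maximal_constant:
  assumes "stoltz n k"
  obtains C :: real and lm :: nat where "C > 0" and "\<And>l. l \<ge> lm \<Longrightarrow> k l > 0"
    and "\<And>E (L :: nat \<Rightarrow> nat) g lam M. finite E \<Longrightarrow> (\<And>z. z \<in> E \<Longrightarrow> L z \<ge> lm) \<Longrightarrow>
      (\<And>z. z \<in> E \<Longrightarrow> (\<Sum>j=1..k (L z). g (z + n (L z) + j)) > lam * real (k (L z))) \<Longrightarrow>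
      (\<And>z. z \<in> E \<Longrightarrow> z + n (L z) + k (L z) < M) \<Longrightarrow>
      (\<And>i. g i \<ge> 0) \<Longrightarrow> lam > 0 \<Longrightarrow> lam * real (card E) \<le> C * (\<Sum>i<M. g i)"
proof -
  from assms obtain Z :: "(int \<times> nat) set" and h :: "nat \<Rightarrow> real" and hm a A :: real where
    h: "filterlim h at_top at_top" "\<forall>t\<ge>1. \<forall>l\<ge>t. (int (n l), k l) \<in> upper_part Z (h t)"
    and a: "a > 0" and A: "A > 0"
    and sec: "\<And>l. l > 0 \<Longrightarrow> finite (cone_section Z hm a l) \<and>
                  real (card (cone_section Z hm a l)) \<le> A * real l"
    unfolding stoltz_def by blast
  have "\<forall>\<^sub>F t in at_top. h t \<ge> max 1 hm"
    using h(1) unfolding filterlim_at_top by blast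
  then have "\<forall>\<^sub>F t in at_top. h t \<ge> max 1 hm \<and> t \<ge> 1"
    using eventually_ge_at_top by (rule eventually_conj)
  \<comment> \<open>The bound \<open>hm\<close> puts all later pairs into the part of
    \<open>Z\<close> with controlled sections; the bound 1 makes \<open>k l\<close>
    positive.\<close>
  then obtain lm where lm: "h lm \<ge> max 1 hm" "lm \<ge> 1"
    by (auto simp: eventually_at_top_linorder)
  have mem: "(int (n l), k l) \<in> upper_part Z hm" "k l > 0" if "l \<ge> lm" for l
  proof -
    have "(int (n l), k l) \<in> upper_part Z (h lm)"
      using h(2) lm(2) that by blast
    with lm(1) show "(int (n l), k l) \<in> upper_part Z hm" "k l > 0"
      by (auto simp: upper_part_def intro: Nat.gr0I)
  qed
  have "A * (2 + 1 / a) > 0"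
    using A a by (intro mult_pos_pos add_pos_pos) auto
  then show thesis
  proof (rule that[where lm = lm])
    show "k l > 0" if "l \<ge> lm" for l
      using mem(2) that .
  next
    fix E and L :: "nat \<Rightarrow> nat" and g :: "nat \<Rightarrow> real" and lam M
    assume *: "finite E" "\<And>z. z \<in> E \<Longrightarrow> L z \<ge> lm"
      "\<And>z. z \<in> E \<Longrightarrow> (\<Sum>j=1..k (L z). g (z + n (L z) + j)) > lam * real (k (L z))"
      "\<And>z. z \<in> E \<Longrightarrow> z + n (L z) + k (L z) < M" "\<And>i. g i \<ge> 0" "lam > 0"
    show "lam * real (card E) \<le> A * (2 + 1 / a) * (\<Sum>i<M. g i)"
    proof (rule stoltz_card_bound[where Z = Z and hm = hm and n = n and k = k and L = L, OF a A])
      show "(int (n (L z)), k (L z)) \<in> upper_part Z hm \<and> k (L z) > 0" if "z \<in> E" for z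
        using mem *(2) that by simp
    qed (use sec * in \<open>simp_all\<close>)
  qed
qed

text \<open>Taking \<open>t = l\<close> in the Stoltz condition gives
  \<open>k l \<ge> h l\<close>.\<close>

lemma stoltz_filterlim:
  assumes "stoltz n k"
  shows "filterlim k at_top sequentially"
proof -
  from assms obtain Z :: "(int \<times> nat) set" and h :: "nat \<Rightarrow> real" where
    h: "filterlim h at_top at_top" "\<forall>t\<ge>1. \<forall>l\<ge>t. (int (n l), k l) \<in> upper_part Z (h t)"
    unfolding stoltz_def by blast
  have "\<forall>\<^sub>F l in sequentially. h l \<le> real (k l)"
    using eventually_ge_at_top[of 1]
  proof eventually_elim
    case (elim l)
    with h(2) have "(int (n l), k l) \<in> upper_part Z (h l)"
      by blast
    then show ?case
      by (simp add: upper_part_def)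
  qed
  then have "filterlim (\<lambda>l. real (k l)) at_top sequentially"
    by (rule filterlim_at_top_mono[OF h(1)])
  then show ?thesis
    by (simp add: filterlim_sequentially_iff_filterlim_real)
qed

subsection \<open>Moving averages for measure-preserving maps\<close>

locale measure_preserving = prob_space M for M :: "'a measure" +
  fixes T :: "'a \<Rightarrow> 'a"
  assumes measurable_map [measurable]: "T \<in> measurable M M"
    and distr_map: "distr M M T = M"
begin

lemma measurable_funpow [measurable]: "T ^^ j \<in> measurable M M"
  by (induction j) (auto intro: measurable_compose[OF _ measurable_map])

lemma distr_funpow: "distr M M (T ^^ j) = M"
proof (induction j)
  case (Suc j)
  have "distr M M (T ^^ Suc j) = distr (distr M M (T ^^ j)) M T"
    by (simp add: distr_distr)
  then show ?case
    by (simp only: Suc distr_map)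
qed (simp add: distr_id)

lemma integrable_funpow:
  fixes g :: "'a \<Rightarrow> 'b::{banach, second_countable_topology}"
  assumes "integrable M g"
  shows "integrable M (\<lambda>x. g ((T ^^ j) x))"
  using integrable_distr[of "T ^^ j" M M g] assms by (simp add: distr_funpow)

lemma integral_funpow:
  fixes g :: "'a \<Rightarrow> 'b::{banach, second_countable_topology}"
  assumes [measurable]: "g \<in> borel_measurable M"
  shows "(LINT x|M. g ((T ^^ j) x)) = (LINT x|M. g x)"
  using integral_distr[of "T ^^ j" M M g] by (simp add: distr_funpow)

lemma AE_map: "AE x in M. P x \<Longrightarrow> AE x in M. P (T x)"
  using AE_distrD[OF measurable_map] unfolding distr_map .

end

locale stoltz_averages = measure_preserving M T for M :: "'a measure" and T +
  fixes n k :: "nat \<Rightarrow> nat"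
  assumes stoltz: "stoltz n k"
begin

definition avg :: "nat \<Rightarrow> ('a \<Rightarrow> complex) \<Rightarrow> 'a \<Rightarrow> complex" where
  "avg l g x = 1 / of_nat (k l) * (\<Sum>j=1..k l. g ((T ^^ (n l + j)) x))"

definition good :: "('a \<Rightarrow> complex) \<Rightarrow> bool" where
  "good g \<longleftrightarrow> integrable M g \<and> (AE x in M. (\<lambda>l. avg l g x) \<longlonglongrightarrow> (LINT x|M. g x))"

text \<open>
  Transference: integrating the counting bound along orbits of length \<open>N\<close> costs a bounded number of
  extra terms at the end of each orbit, which disappears as \<open>N \<longrightarrow> \<infinity>\<close>.
\<close>

lemma maximal_inequality:
  obtains C :: real and lm :: nat where "C > 0" and "\<And>l. l \<ge> lm \<Longrightarrow> k l > 0"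
    and "\<And>g :: 'a \<Rightarrow> real. \<And>lam. integrable M g \<Longrightarrow> (\<And>x. g x \<ge> 0) \<Longrightarrow> lam > 0 \<Longrightarrow>
      lam * prob {x\<in>space M. \<exists>l\<ge>lm. (\<Sum>j=1..k l. g ((T ^^ (n l + j)) x)) > lam * real (k l)}
        \<le> C * (LINT x|M. g x)"
proof -
  obtain C lm where C: "C > 0" and kpos: "\<And>l. l \<ge> lm \<Longrightarrow> k l > 0"
    and cnt: "\<And>E (L :: nat \<Rightarrow> nat) g lam M. finite E \<Longrightarrow> (\<And>z. z \<in> E \<Longrightarrow> L z \<ge> lm) \<Longrightarrow>
      (\<And>z. z \<in> E \<Longrightarrow> (\<Sum>j=1..k (L z). g (z + n (L z) + j)) > lam * real (k (L z))) \<Longrightarrow>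
      (\<And>z. z \<in> E \<Longrightarrow> z + n (L z) + k (L z) < M) \<Longrightarrow>
      (\<And>i. g i \<ge> 0) \<Longrightarrow> lam > 0 \<Longrightarrow> lam * real (card E) \<le> C * (\<Sum>i<M. g i)"
    using stoltz_maximal_constant[OF stoltz] by blast
  show thesis
  proof (rule that[OF C kpos])
    fix g :: "'a \<Rightarrow> real" and lam :: real
    assume int_g: "integrable M g" and g: "\<And>x. g x \<ge> 0" and lam: "lam > 0"
    have [measurable]: "g \<in> borel_measurable M"
      using int_g by auto
    define P where "P l x \<longleftrightarrow> (\<Sum>j=1..k l. g ((T ^^ (n l + j)) x)) > lam * real (k l)" for l x
    have [measurable]: "Measurable.pred M (P l)" for l
      unfolding P_def by measurable
    \<comment> \<open>Only finitely many windows occur up to the cutoff \<open>m\<close>, so their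
      reach \<open>n l + k l\<close> is bounded. Letting \<open>m\<close> tend to infinity at the
      end restores the full maximal set.\<close>
    define E where "E m = {x\<in>space M. \<exists>l\<in>{lm..m}. P l x}" for m
    have [measurable]: "E m \<in> sets M" for m
      unfolding E_def by measurable
    have bound: "lam * prob (E m) \<le> C * (LINT x|M. g x)" for m
    proof (rule ccontr)
      assume less: "\<not> ?thesis"
      define R where "R = (\<Sum>l\<le>m. n l + k l) + 1"
      define \<delta> where "\<delta> = lam * prob (E m) - C * (LINT x|M. g x)"
      have "\<delta> > 0"
        using less by (simp add: \<delta>_def)
      \<comment> \<open>The left side grows linearly in \<open>N\<close> while the boundary term on
        the right is independent of \<open>N\<close>, so \<open>\<delta>\<close> cannot be
        positive.\<close>
      have main: "real N * \<delta> \<le> C * real R * (LINT x|M. g x)" for N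
      proof -
        \<comment> \<open>The counting bound is applied to the orbit sequence
          \<open>g ((T ^^ i) x)\<close>: a visit of the orbit to \<open>E m\<close> at time
          \<open>z\<close> means that this sequence has a large moving average at
          \<open>z\<close>.\<close>
        have pw: "lam * (\<Sum>z<N. indicator (E m) ((T ^^ z) x)) \<le> C * (\<Sum>i<N+R. g ((T ^^ i) x))"
          if x: "x \<in> space M" for x
        proof -
          define E' where "E' = {z. z < N \<and> (T ^^ z) x \<in> E m}"
          define L where "L z = (SOME l. l \<in> {lm..m} \<and> P l ((T ^^ z) x))" for z
          have L: "L z \<in> {lm..m}" "P (L z) ((T ^^ z) x)" if "z \<in> E'" for z
          proof -
            have "\<exists>l. l \<in> {lm..m} \<and> P l ((T ^^ z) x)"
              using that by (auto simp: E'_def E_def)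
            then have "L z \<in> {lm..m} \<and> P (L z) ((T ^^ z) x)"
              unfolding L_def by (rule someI_ex)
            then show "L z \<in> {lm..m}" "P (L z) ((T ^^ z) x)"
              by auto
          qed
          have "lam * real (card E') \<le> C * (\<Sum>i<N+R. g ((T ^^ i) x))"
          proof (rule cnt[of E' L])
            show "finite E'"
              by (simp add: E'_def)
            show "L z \<ge> lm" if "z \<in> E'" for z
              using L(1)[OF that] by simp
            show "(\<Sum>j=1..k (L z). g ((T ^^ (z + n (L z) + j)) x)) > lam * real (k (L z))"
              if "z \<in> E'" for z
            proof -
              have "z + n (L z) + j = (n (L z) + j) + z" for j
                by simp
              then show ?thesis
                using L(2)[OF that] unfolding P_def by (simp only: funpow_add o_apply)
            qed
            show "z + n (L z) + k (L z) < N + R" if "z \<in> E'" for z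
            proof -
              have "n (L z) + k (L z) \<le> (\<Sum>l\<le>m. n l + k l)"
                using L(1)[OF that] by (intro member_le_sum) auto
              then show ?thesis
                using that by (simp add: E'_def R_def)
            qed
          qed (use g lam in auto)
          also have "real (card E') = (\<Sum>z<N. indicator (E m) ((T ^^ z) x))"
          proof -
            have "E' = {z\<in>{..<N}. (T ^^ z) x \<in> E m}"
              by (auto simp: E'_def)
            then show ?thesis
              by (simp add: indicator_def sum.If_cases Int_def)
          qed
          finally show ?thesis .
        qed
        have int_ind: "integrable M (\<lambda>x. indicator (E m) ((T ^^ z) x) :: real)" for z
          by (intro integrable_funpow integrable_const_bound[of _ 1]) (auto simp: indicator_def)
        have "(LINT x|M. lam * (\<Sum>z<N. indicator (E m) ((T ^^ z) x)))
            \<le> (LINT x|M. C * (\<Sum>i<N+R. g ((T ^^ i) x)))"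
          using pw int_ind integrable_funpow[OF int_g]
          by (intro integral_mono integrable_mult_right Bochner_Integration.integrable_sum) auto
        also have "(LINT x|M. lam * (\<Sum>z<N. indicator (E m) ((T ^^ z) x))) = lam * (real N * prob (E m))"
          using int_ind integral_funpow[of "indicator (E m) :: _ \<Rightarrow> real"]
          by (subst integral_mult_right_zero, subst Bochner_Integration.integral_sum) auto
        also have "(LINT x|M. C * (\<Sum>i<N+R. g ((T ^^ i) x))) = C * (real (N + R) * (LINT x|M. g x))"
          using integrable_funpow[OF int_g] integral_funpow[of g]
          by (subst integral_mult_right_zero, subst Bochner_Integration.integral_sum) auto
        finally show ?thesis
          by (simp add: \<delta>_def algebra_simps)
      qed
      obtain N :: nat where "C * real R * (LINT x|M. g x) < real N * \<delta>"
        using reals_Archimedean3[OF \<open>\<delta> > 0\<close>] by blast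
      then show False
        using main[of N] by simp
    qed
    have "(\<lambda>m. prob (E m)) \<longlonglongrightarrow> prob (\<Union>m. E m)"
      by (rule finite_Lim_measure_incseq) (auto simp: E_def incseq_def)
    then have "(\<lambda>m. lam * prob (E m)) \<longlonglongrightarrow> lam * prob (\<Union>m. E m)"
      by (intro tendsto_intros)
    then have "lam * prob (\<Union>m. E m) \<le> C * (LINT x|M. g x)"
      by (rule LIMSEQ_le_const2) (use bound in blast)
    also have "(\<Union>m. E m) = {x\<in>space M. \<exists>l\<ge>lm. P l x}"
      unfolding E_def by (auto, meson atLeastAtMost_iff order_refl)
    finally show "lam * prob {x\<in>space M. \<exists>l\<ge>lm. (\<Sum>j=1..k l. g ((T ^^ (n l + j)) x)) > lam * real (k l)}
        \<le> C * (LINT x|M. g x)"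
      unfolding P_def .
  qed
qed

section \<open>Stability of the class of good functions: linearity, coboundaries, limits in
  mean\<close>

lemma avg_add: "avg l (\<lambda>x. g x + h x) x = avg l g x + avg l h x"
  by (simp add: avg_def sum.distrib distrib_left)

lemma avg_cmult: "avg l (\<lambda>x. c * g x) x = c * avg l g x"
  by (simp add: avg_def sum_distrib_left mult_ac)

lemma avg_const: "k l > 0 \<Longrightarrow> avg l (\<lambda>x. c) x = c"
  by (simp add: avg_def)

lemma good_integrable: "good g \<Longrightarrow> integrable M g"
  by (simp add: good_def)

lemma good_const: "good (\<lambda>x. c)"
proof -
  have "\<forall>\<^sub>F l in sequentially. Suc 0 \<le> k l"
    using stoltz_filterlim[OF stoltz] unfolding filterlim_at_top by blast
  then have "(\<lambda>l. avg l (\<lambda>x. c) x) \<longlonglongrightarrow> c" for x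
    by (rule tendsto_eventually[OF eventually_mono]) (auto intro: avg_const)
  then show ?thesis
    by (simp add: good_def prob_space)
qed

lemma good_add:
  assumes "good g" "good h"
  shows "good (\<lambda>x. g x + h x)"
  using assms unfolding good_def
  by (auto simp: avg_add intro: tendsto_add)

lemma good_cmult:
  assumes "good g"
  shows "good (\<lambda>x. c * g x)"
  using assms unfolding good_def
  by (auto simp: avg_cmult intro: tendsto_mult_left)

lemma good_sum:
  assumes "\<And>i. i \<in> I \<Longrightarrow> good (g i)"
  shows "good (\<lambda>x. \<Sum>i\<in>I. g i x)"
  using assms by (induction I rule: infinite_finite_induct) (auto intro: good_const good_add)

text \<open>The sum over a window telescopes to two boundary terms, so the average is at most
  \<open>2 * B / k l\<close> at every point; invariance of the measure makes the integral 0 as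
  well.\<close>

lemma good_coboundary:
  assumes [measurable]: "g \<in> borel_measurable M" and B: "\<And>x. norm (g x) \<le> B"
  shows "good (\<lambda>x. g x - g (T x))"
proof -
  have int_g: "integrable M g"
    by (rule integrable_const_bound[of _ B]) (use B in auto)
  have int_gT: "integrable M (\<lambda>x. g (T x))" "(LINT x|M. g (T x)) = (LINT x|M. g x)"
    using integrable_funpow[OF int_g, of 1] integral_funpow[of g 1] by auto
  have "(\<lambda>l. avg l (\<lambda>x. g x - g (T x)) x) \<longlonglongrightarrow> 0" for x
  proof (rule Lim_null_comparison)
    show "\<forall>\<^sub>F l in sequentially. norm (avg l (\<lambda>x. g x - g (T x)) x) \<le> 2 * B * (1 / real (k l))"
    proof (rule always_eventually, rule allI)
      fix l
      define a where "a i = g ((T ^^ (n l + i)) x)" for i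
      have "(\<Sum>j=1..m. a j - a (Suc j)) = a 1 - a (Suc m)" for m
        by (induction m) simp_all
      then have "avg l (\<lambda>x. g x - g (T x)) x = 1 / of_nat (k l) * (a 1 - a (Suc (k l)))"
        by (simp add: avg_def a_def)
      moreover have "norm (a 1 - a (Suc (k l))) \<le> 2 * B"
        using norm_triangle_ineq4[of "a 1" "a (Suc (k l))"] B by (smt (verit) a_def)
      ultimately show "norm (avg l (\<lambda>x. g x - g (T x)) x) \<le> 2 * B * (1 / real (k l))"
        by (simp add: norm_divide divide_right_mono)
    qed
    have "(\<lambda>l. 1 / real (k l)) \<longlonglongrightarrow> 0"
      using filterlim_compose[OF lim_1_over_n stoltz_filterlim[OF stoltz]] by simp
    then show "(\<lambda>l. 2 * B * (1 / real (k l))) \<longlonglongrightarrow> 0"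
      by (rule tendsto_mult_right_zero)
  qed
  then show ?thesis
    using int_g int_gT by (simp add: good_def)
qed

text \<open>The difference is a telescoping sum of the coboundaries of \<open>g\<close>,
  \<open>g\<close> after \<open>T\<close>, and so on up to the power \<open>d - 1\<close>.\<close>

lemma good_minus_funpow:
  assumes [measurable]: "g \<in> borel_measurable M" and B: "\<And>x. norm (g x) \<le> B"
  shows "good (\<lambda>x. g x - g ((T ^^ d) x))"
proof (induction d)
  case (Suc d)
  have "good (\<lambda>x. g ((T ^^ d) x) - g ((T ^^ d) (T x)))"
    by (rule good_coboundary) (use B in auto)
  from good_add[OF Suc this] show ?case
    by (simp add: funpow_swap1)
qed (use good_const[of 0] in simp)

text \<open>Banach principle: if a good \<open>h\<close> is close to \<open>g\<close> in mean, the
  maximal inequality for \<open>norm (g x - h x)\<close> shows that the averages of \<open>g\<close>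
  and \<open>h\<close> stay uniformly close off a set of small measure. Hence the set where the
  averages of \<open>g\<close> fail to converge is null.\<close>

lemma good_limit:
  assumes int_g: "integrable M g"
    and approx: "\<And>\<epsilon>. \<epsilon> > 0 \<Longrightarrow> \<exists>h. good h \<and> (LINT x|M. norm (g x - h x)) < \<epsilon>"
  shows "good g"
proof -
  obtain C lm where C: "C > 0" and kpos: "\<And>l. l \<ge> lm \<Longrightarrow> k l > 0"
    and mx: "\<And>g :: 'a \<Rightarrow> real. \<And>lam. integrable M g \<Longrightarrow> (\<And>x. g x \<ge> 0) \<Longrightarrow> lam > 0 \<Longrightarrow>
      lam * prob {x\<in>space M. \<exists>l\<ge>lm. (\<Sum>j=1..k l. g ((T ^^ (n l + j)) x)) > lam * real (k l)}
        \<le> C * (LINT x|M. g x)"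
    using maximal_inequality by blast
  have [measurable]: "g \<in> borel_measurable M"
    using int_g by auto
  let ?c = "LINT x|M. g x"
  have [measurable]: "avg l g \<in> borel_measurable M" for l
    unfolding avg_def by measurable
  have null: "AE x in M. \<exists>m. \<forall>l\<ge>m. norm (avg l g x - ?c) \<le> 3 * \<delta>" if \<delta>: "\<delta> > 0" for \<delta>
  proof -
    define D where "D = {x\<in>space M. \<not> (\<exists>m. \<forall>l\<ge>m. norm (avg l g x - ?c) \<le> 3 * \<delta>)}"
    have [measurable]: "D \<in> sets M"
      unfolding D_def by measurable
    have small: "prob D \<le> \<epsilon>" if \<epsilon>: "\<epsilon> > 0" for \<epsilon>
    proof -
      \<comment> \<open>The first entry controls the difference of the two integrals, the second
        makes the maximal bound \<open>C * \<eta> / \<delta>\<close> at most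
        \<open>\<epsilon>\<close>.\<close>
      define \<eta> where "\<eta> = min \<delta> (\<epsilon> * \<delta> / C)"
      have "\<eta> > 0"
        using \<delta> \<epsilon> C by (simp add: \<eta>_def)
      then obtain h where h: "good h" and gh: "(LINT x|M. norm (g x - h x)) < \<eta>"
        using approx by blast
      have int_h: "integrable M h"
        using h by (rule good_integrable)
      let ?F = "{x\<in>space M. \<exists>l\<ge>lm. (\<Sum>j=1..k l. norm (g ((T ^^ (n l + j)) x) - h ((T ^^ (n l + j)) x))) > \<delta> * real (k l)}"
      have [measurable]: "h \<in> borel_measurable M"
        using int_h by auto
      have F: "?F \<in> sets M"
        by measurable
      have "\<delta> * prob ?F \<le> C * (LINT x|M. norm (g x - h x))"
        by (rule mx[of "\<lambda>x. norm (g x - h x)"]) (use int_g int_h \<delta> in auto)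
      also have "\<dots> \<le> C * \<eta>"
        using C gh by simp
      also have "\<dots> \<le> C * (\<epsilon> * \<delta> / C)"
        using C by (intro mult_left_mono) (auto simp: \<eta>_def)
      also have "\<dots> = \<delta> * \<epsilon>"
        using C by simp
      finally have PF: "prob ?F \<le> \<epsilon>"
        using \<delta> by simp
      have "norm ((LINT x|M. h x) - ?c) = norm (LINT x|M. h x - g x)"
        using int_g int_h by simp
      also have "\<dots> \<le> (LINT x|M. norm (h x - g x))"
        by (rule integral_norm_bound)
      also have "\<dots> < \<delta>"
        using gh by (simp add: norm_minus_commute \<eta>_def)
      finally have ch: "norm ((LINT x|M. h x) - ?c) < \<delta>" .
      have "AE x in M. (\<lambda>l. avg l h x) \<longlonglongrightarrow> (LINT x|M. h x)"
        using h by (simp add: good_def)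
      \<comment> \<open>Off the maximal set three errors of size \<open>\<delta>\<close> add up to
        \<open>3 * \<delta>\<close>: between the averages of \<open>g\<close> and \<open>h\<close>,
        between the average and the integral of \<open>h\<close>, and between the two
        integrals.\<close>
      then have "AE x in M. x \<in> D \<longrightarrow> x \<in> ?F"
      proof eventually_elim
        case (elim x)
        show ?case
        proof (intro impI, rule ccontr)
          assume xD: "x \<in> D" and xF: "x \<notin> ?F"
          have "\<forall>\<^sub>F l in sequentially. norm (avg l h x - (LINT x|M. h x)) < \<delta>"
            using elim \<delta> by (auto dest: tendstoD simp: dist_norm)
          then obtain m where m: "\<And>l. l \<ge> m \<Longrightarrow> norm (avg l h x - (LINT x|M. h x)) < \<delta>"
            by (auto simp: eventually_sequentially)
          have "norm (avg l g x - ?c) \<le> 3 * \<delta>" if l: "l \<ge> max m lm" for l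
          proof -
            let ?S = "\<Sum>j=1..k l. norm (g ((T ^^ (n l + j)) x) - h ((T ^^ (n l + j)) x))"
            have "avg l g x - avg l h x
                = (\<Sum>j=1..k l. g ((T ^^ (n l + j)) x) - h ((T ^^ (n l + j)) x)) / of_nat (k l)"
              by (simp add: avg_def sum_subtractf diff_divide_distrib)
            also have "norm \<dots> \<le> ?S / real (k l)"
              by (simp add: norm_divide divide_right_mono norm_sum)
            also have "\<dots> \<le> \<delta>"
            proof -
              have "?S \<le> \<delta> * real (k l)"
                using xF xD l by (force simp: D_def)
              then show ?thesis
                using kpos[of l] l by (simp add: field_simps)
            qed
            finally have "norm (avg l g x - avg l h x) \<le> \<delta>" .
            then show ?thesis
              using m[of l] l ch
                norm_triangle_ineq[of "avg l g x - avg l h x" "avg l h x - (LINT x|M. h x)"]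
                norm_triangle_ineq[of "avg l g x - (LINT x|M. h x)" "(LINT x|M. h x) - ?c"]
              by simp
          qed
          then have "\<exists>m. \<forall>l\<ge>m. norm (avg l g x - ?c) \<le> 3 * \<delta>"
            by blast
          then show False
            using xD unfolding D_def by blast
        qed
      qed
      then have "prob D \<le> prob ?F"
        using F by (intro finite_measure_mono_AE) auto
      with PF show ?thesis
        by simp
    qed
    have "prob D \<le> 0"
      by (rule field_le_epsilon) (use small in simp)
    then have "prob D = 0"
      using measure_nonneg[of M D] by linarith
    then have "D \<in> null_sets M"
      by (simp add: null_sets_def emeasure_eq_measure)
    then have "AE x in M. x \<notin> D"
      by (rule AE_not_in)
    with AE_space show ?thesis
      by eventually_elim (auto simp: D_def)
  qed
  \<comment> \<open>Restricting to the countably many tolerances \<open>1 / Suc i\<close> leaves a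
    single exceptional null set.\<close>
  have "AE x in M. \<forall>i. \<exists>m. \<forall>l\<ge>m. norm (avg l g x - ?c) \<le> 3 * (1 / real (Suc i))"
    by (subst AE_all_countable) (intro allI null, simp)
  then have "AE x in M. (\<lambda>l. avg l g x) \<longlonglongrightarrow> ?c"
  proof eventually_elim
    case (elim x)
    show ?case
    proof (rule LIMSEQ_I)
      fix r :: real assume "r > 0"
      then obtain i where i: "1 / real (Suc i) < r / 3"
        using reals_Archimedean[of "r / 3"] by (auto simp: inverse_eq_divide)
      obtain m where "\<forall>l\<ge>m. norm (avg l g x - ?c) \<le> 3 * (1 / real (Suc i))"
        using elim by blast
      with i show "\<exists>m. \<forall>l\<ge>m. norm (avg l g x - ?c) < r"
        by (intro exI[of _ m]) force
    qed
  qed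
  then show ?thesis
    using int_g by (simp add: good_def)
qed

text \<open>
  The difference between \<open>g\<close> and its Birkhoff mean of length \<open>N\<close> is a bounded coboundary, so only the
  smallness of these means in mean is needed.
\<close>

lemma good_of_mean_ergodic:
  assumes [measurable]: "g \<in> borel_measurable M" and B: "\<And>x. norm (g x) \<le> B"
    and lim: "(\<lambda>N. LINT x|M. norm (1 / of_nat (Suc N) * (\<Sum>d<Suc N. g ((T ^^ d) x)))) \<longlonglongrightarrow> 0"
  shows "good g"
proof (rule good_limit)
  show "integrable M g"
    by (rule integrable_const_bound[of _ B]) (use B in auto)
  fix \<epsilon> :: real assume "\<epsilon> > 0"
  with lim have "\<forall>\<^sub>F N in sequentially.
      (LINT x|M. norm (1 / of_nat (Suc N) * (\<Sum>d<Suc N. g ((T ^^ d) x)))) < \<epsilon>"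
    by (rule order_tendstoD(2))
  then obtain N where N: "(LINT x|M. norm (1 / of_nat (Suc N) * (\<Sum>d<Suc N. g ((T ^^ d) x)))) < \<epsilon>"
    by (auto simp: eventually_sequentially)
  \<comment> \<open>Written as a mean of differences, \<open>h\<close> is good term by term, and
    \<open>g - h\<close> is exactly the Birkhoff mean of \<open>g\<close>. The length
    \<open>Suc N\<close> avoids an empty mean.\<close>
  define h where "h x = 1 / of_nat (Suc N) * (\<Sum>d<Suc N. g x - g ((T ^^ d) x))" for x
  have "good h"
    unfolding h_def by (intro good_cmult good_sum good_minus_funpow[OF _ B]) simp
  moreover have "g x - h x = 1 / of_nat (Suc N) * (\<Sum>d<Suc N. g ((T ^^ d) x))" for x
    unfolding h_def by (simp add: sum_subtractf right_diff_distrib field_simps del: sum.lessThan_Suc of_nat_Suc)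
  ultimately show "\<exists>h. good h \<and> (LINT x|M. norm (g x - h x)) < \<epsilon>"
    using N by auto
qed

end

subsection \<open>The Cauchy measure and the Boole map\<close>

definition cauchy_density :: "real \<Rightarrow> real \<Rightarrow> real \<Rightarrow> real" where
  "cauchy_density \<alpha> \<beta> x = \<alpha> / pi / (\<alpha>\<^sup>2 + (x - \<beta>)\<^sup>2)"

definition cauchy_measure :: "real \<Rightarrow> real \<Rightarrow> real measure" where
  "cauchy_measure \<alpha> \<beta> = density lborel (\<lambda>x. ennreal (cauchy_density \<alpha> \<beta> x))"

lemma sets_cauchy [measurable_cong, simp]: "sets (cauchy_measure \<alpha> \<beta>) = sets borel"
  and space_cauchy [simp]: "space (cauchy_measure \<alpha> \<beta>) = UNIV"
  by (simp_all add: cauchy_measure_def)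

lemma borel_cauchy_density [measurable]: "cauchy_density \<alpha> \<beta> \<in> borel_measurable borel"
  unfolding cauchy_density_def by measurable

lemma boole_map_measurable [measurable]: "boole_map \<alpha> \<beta> \<in> borel_measurable borel"
  unfolding boole_map_def by measurable

text \<open>A Cayley transform of the line onto the unit circle without 1; the missing point
  corresponds to infinity.\<close>

definition circle_coord :: "real \<Rightarrow> real \<Rightarrow> real \<Rightarrow> complex" where
  "circle_coord \<alpha> \<beta> x = Complex (x - \<beta>) \<alpha> / Complex (x - \<beta>) (- \<alpha>)"

text \<open>The numbers \<open>b + r\<close> and \<open>b - r\<close> are the roots of
  \<open>u^2 - 2 b u - 1 = 0\<close>, with sum \<open>2 b\<close> and product -1, so the addition
  formula for the tangent gives \<open>b\<close>. One arctangent is positive and the other negative,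
  which keeps their sum inside the principal range. This adds up the masses of the two inverse
  branches of the Boole map.\<close>

lemma arctan_add_conj:
  fixes b :: real
  defines "r \<equiv> sqrt (b\<^sup>2 + 1)"
  shows "arctan (b + r) + arctan (b - r) = arctan b"
proof -
  have r: "r\<^sup>2 = b\<^sup>2 + 1" "r > \<bar>b\<bar>"
    by (auto simp: r_def intro: real_less_rsqrt)
  have *: "0 < arctan (b + r)" "arctan (b - r) < 0"
    using r(2) by auto
  have "arctan (b + r) < pi / 2" "- (pi / 2) < arctan (b - r)"
    using arctan_ubound arctan_lbound by auto
  with * have range: "- (pi / 2) < arctan (b + r) + arctan (b - r)"
    "arctan (b + r) + arctan (b - r) < pi / 2"
    by linarith+
  have "cos (arctan (b + r) + arctan (b - r)) > 0"
    using range by (intro cos_gt_zero_pi) auto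
  then have "tan (arctan (b + r) + arctan (b - r)) = (b + r + (b - r)) / (1 - (b + r) * (b - r))"
    by (subst tan_add) (auto simp: tan_arctan)
  also have "(b + r) * (b - r) = - 1"
    using r(1) by (simp add: algebra_simps power2_eq_square)
  finally have "tan (arctan (b + r) + arctan (b - r)) = b"
    by simp
  then show ?thesis
    using range arctan_unique by metis
qed

context
  fixes \<alpha> \<beta> :: real
  assumes alpha: "\<alpha> > 0"
begin

lemma cauchy_denom_pos: "\<alpha>\<^sup>2 + (x - \<beta>)\<^sup>2 > 0"
  using alpha by (simp add: add_pos_nonneg)

lemma cauchy_density_pos: "cauchy_density \<alpha> \<beta> x > 0"
  using alpha cauchy_denom_pos by (simp add: cauchy_density_def)

lemma isCont_cauchy_density: "isCont (cauchy_density \<alpha> \<beta>) x"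
  unfolding cauchy_density_def using cauchy_denom_pos[of x] alpha
  by (intro continuous_intros) auto

lemma DERIV_cauchy: "((\<lambda>x. arctan ((x - \<beta>) / \<alpha>) / pi) has_real_derivative cauchy_density \<alpha> \<beta> x) (at x)"
proof -
  have "((\<lambda>x. arctan ((x - \<beta>) / \<alpha>) / pi) has_real_derivative
      inverse (1 + ((x - \<beta>) / \<alpha>)\<^sup>2) * (1 / \<alpha>) / pi) (at x)"
    using alpha by (auto intro!: derivative_eq_intros)
  moreover have "inverse (1 + ((x - \<beta>) / \<alpha>)\<^sup>2) * (1 / \<alpha>) / pi = cauchy_density \<alpha> \<beta> x"
    using alpha cauchy_denom_pos[of x]
    by (simp add: cauchy_density_def field_simps power2_eq_square)
  ultimately show ?thesis
    by simp
qed

lemma filterlim_affine_at_top: "filterlim (\<lambda>x. (x - \<beta>) / \<alpha>) at_top at_top"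
  and filterlim_affine_at_bot: "filterlim (\<lambda>x. (x - \<beta>) / \<alpha>) at_bot at_bot"
  using alpha by real_asymp+

lemma cauchy_cdf_at_bot: "((\<lambda>x. arctan ((x - \<beta>) / \<alpha>) / pi) \<longlongrightarrow> - (1 / 2)) at_bot"
  using tendsto_divide[OF filterlim_compose[OF tendsto_arctan_at_bot filterlim_affine_at_bot] tendsto_const[of pi]]
  by simp

lemma cauchy_cdf_at_top: "((\<lambda>x. arctan ((x - \<beta>) / \<alpha>) / pi) \<longlongrightarrow> 1 / 2) at_top"
  using tendsto_divide[OF filterlim_compose[OF tendsto_arctan_at_top filterlim_affine_at_top] tendsto_const[of pi]]
  by simp

lemma cauchy_integral:
  shows "integrable lborel (cauchy_density \<alpha> \<beta>)" "(LINT x|lborel. cauchy_density \<alpha> \<beta> x) = 1"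
proof -
  note * = interval_integral_FTC_nonneg[of "-\<infinity>" "\<infinity>" "\<lambda>x. arctan ((x - \<beta>) / \<alpha>) / pi"
      "cauchy_density \<alpha> \<beta>" "- (1 / 2)" "1 / 2"]
  have "set_integrable lborel (einterval (-\<infinity>) \<infinity>) (cauchy_density \<alpha> \<beta>)"
    "(LBINT x=-\<infinity>..\<infinity>. cauchy_density \<alpha> \<beta> x) = 1 / 2 - - (1 / 2)"
    using cauchy_cdf_at_bot cauchy_cdf_at_top
    by (intro *; simp add: DERIV_cauchy isCont_cauchy_density less_imp_le cauchy_density_pos
          ereal_tendsto_simps)+
  then show "integrable lborel (cauchy_density \<alpha> \<beta>)" "(LINT x|lborel. cauchy_density \<alpha> \<beta> x) = 1"
    by (simp_all add: set_integrable_def interval_lebesgue_integral_def set_lebesgue_integral_def)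
qed

lemma prob_space_cauchy: "prob_space (cauchy_measure \<alpha> \<beta>)"
proof
  have "emeasure (cauchy_measure \<alpha> \<beta>) UNIV = (\<integral>\<^sup>+x. ennreal (cauchy_density \<alpha> \<beta> x) \<partial>lborel)"
    by (simp add: cauchy_measure_def emeasure_density)
  also have "\<dots> = ennreal 1"
    using cauchy_integral cauchy_density_pos
    by (subst nn_integral_eq_integral) (auto intro: less_imp_le)
  finally show "emeasure (cauchy_measure \<alpha> \<beta>) (space (cauchy_measure \<alpha> \<beta>)) = 1"
    by simp
qed

text \<open>The density is positive everywhere, so both measures have the same null sets; the final
  statement about Lebesgue almost all points rests on this.\<close>

lemma AE_cauchy_iff: "(AE x in cauchy_measure \<alpha> \<beta>. P x) \<longleftrightarrow> (AE x in lborel. P x)"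
  unfolding cauchy_measure_def by (subst AE_density) (auto simp: cauchy_density_pos)

lemma cauchy_singleton: "{x} \<in> null_sets (cauchy_measure \<alpha> \<beta>)"
  using AE_lborel_singleton[of x] AE_iff_null_sets[of "{x}" "cauchy_measure \<alpha> \<beta>"]
  by (simp add: AE_cauchy_iff)

lemma integrable_cauchy_iff:
  fixes g :: "real \<Rightarrow> complex"
  assumes [measurable]: "g \<in> borel_measurable borel"
  shows "integrable (cauchy_measure \<alpha> \<beta>) g \<longleftrightarrow> integrable lborel (\<lambda>x. cauchy_density \<alpha> \<beta> x *\<^sub>R g x)"
  unfolding cauchy_measure_def
  by (rule integrable_density) (auto intro: less_imp_le cauchy_density_pos)

lemma integral_cauchy:
  fixes g :: "real \<Rightarrow> complex"
  assumes [measurable]: "g \<in> borel_measurable borel"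
  shows "(LINT x|cauchy_measure \<alpha> \<beta>. g x) = (LINT x|lborel. cauchy_density \<alpha> \<beta> x *\<^sub>R g x)"
  unfolding cauchy_measure_def
  by (rule integral_density) (auto intro: less_imp_le cauchy_density_pos)

lemma measure_cauchy_atMost: "measure (cauchy_measure \<alpha> \<beta>) {..a} = 1 / 2 + arctan ((a - \<beta>) / \<alpha>) / pi"
proof -
  interpret prob_space "cauchy_measure \<alpha> \<beta>"
    by (rule prob_space_cauchy)
  note * = interval_integral_FTC_nonneg[of "-\<infinity>" "ereal a" "\<lambda>x. arctan ((x - \<beta>) / \<alpha>) / pi"
      "cauchy_density \<alpha> \<beta>" "- (1 / 2)" "arctan ((a - \<beta>) / \<alpha>) / pi"]
  have lim: "((\<lambda>x. arctan ((x - \<beta>) / \<alpha>) / pi) \<longlongrightarrow> arctan ((a - \<beta>) / \<alpha>) / pi) (at_left a)"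
    using alpha by (auto intro!: tendsto_intros)
  have set: "einterval (-\<infinity>) (ereal a) = {..<a}"
    by (auto simp: einterval_def)
  have I: "set_integrable lborel {..<a} (cauchy_density \<alpha> \<beta>)"
    "(LBINT x:{..<a}. cauchy_density \<alpha> \<beta> x) = arctan ((a - \<beta>) / \<alpha>) / pi - - (1 / 2)"
    using cauchy_cdf_at_bot lim *[unfolded set]
    by (simp_all add: DERIV_cauchy isCont_cauchy_density less_imp_le cauchy_density_pos
          ereal_tendsto_simps interval_lebesgue_integral_def set)
  have "emeasure (cauchy_measure \<alpha> \<beta>) {..<a}
      = (\<integral>\<^sup>+x. ennreal (indicator {..<a} x *\<^sub>R cauchy_density \<alpha> \<beta> x) \<partial>lborel)"
    unfolding cauchy_measure_def
    by (subst emeasure_density) (auto intro!: nn_integral_cong split: split_indicator)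
  also have "\<dots> = ennreal (LBINT x:{..<a}. cauchy_density \<alpha> \<beta> x)"
    unfolding set_lebesgue_integral_def using I(1)
    by (intro nn_integral_eq_integral)
       (auto simp: set_integrable_def less_imp_le cauchy_density_pos intro!: mult_nonneg_nonneg)
  finally have "measure (cauchy_measure \<alpha> \<beta>) {..<a} = (LBINT x:{..<a}. cauchy_density \<alpha> \<beta> x)"
    unfolding set_lebesgue_integral_def measure_def
    by (simp add: less_imp_le cauchy_density_pos integral_nonneg)
  \<comment> \<open>The fundamental theorem was applied to the open ray; its endpoint has measure
    0.\<close>
  moreover have "measure (cauchy_measure \<alpha> \<beta>) ({..<a} \<union> {a}) = measure (cauchy_measure \<alpha> \<beta>) {..<a}"
    by (rule measure_Un_null_set) (auto simp: cauchy_singleton)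
  moreover have "{..<a} \<union> {a} = {..a}"
    by auto
  ultimately show ?thesis
    using I(2) by simp
qed

lemma measure_cauchy_Ioc:
  assumes "a \<le> b"
  shows "measure (cauchy_measure \<alpha> \<beta>) {a<..b} = (arctan ((b - \<beta>) / \<alpha>) - arctan ((a - \<beta>) / \<alpha>)) / pi"
proof -
  interpret prob_space "cauchy_measure \<alpha> \<beta>"
    by (rule prob_space_cauchy)
  have "{a<..b} = {..b} - {..a}"
    by auto
  then show ?thesis
    using assms by (simp add: finite_measure_Diff measure_cauchy_atMost diff_divide_distrib)
qed

text \<open>In the variable \<open>u = (x - \<beta>) / \<alpha>\<close> the map reads
  \<open>u \<mapsto> (u - 1 / u) / 2\<close>, and the inequality becomes a sign condition on
  \<open>(u - (b - r)) * (u - (b + r)) / u\<close>. As \<open>b - r < 0 < b + r\<close>, the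
  solutions form a ray and an interval, one for each branch.\<close>

lemma boole_map_le_iff:
  fixes a x :: real
  defines "b \<equiv> (a - \<beta>) / \<alpha>"
  defines "r \<equiv> sqrt (b\<^sup>2 + 1)"
  assumes x: "x \<noteq> \<beta>"
  shows "boole_map \<alpha> \<beta> x \<le> a \<longleftrightarrow> x \<le> \<beta> + \<alpha> * (b - r) \<or> \<beta> < x \<and> x \<le> \<beta> + \<alpha> * (b + r)"
proof -
  define u where "u = (x - \<beta>) / \<alpha>"
  have xu: "x = \<beta> + \<alpha> * u" and u: "u \<noteq> 0" and ab: "a = \<beta> + \<alpha> * b"
    using alpha x by (auto simp: u_def b_def)
  have r: "r\<^sup>2 = b\<^sup>2 + 1" "r > \<bar>b\<bar>"
    by (auto simp: r_def intro: real_less_rsqrt)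
  have "boole_map \<alpha> \<beta> x = \<beta> + \<alpha> * ((u - 1 / u) / 2)"
    using alpha u x by (simp add: boole_map_def xu field_simps)
  then have "boole_map \<alpha> \<beta> x \<le> a \<longleftrightarrow> u - 1 / u \<le> 2 * b"
    using alpha by (simp add: ab mult.commute)
  also have "u - 1 / u - 2 * b = (u - (b - r)) * (u - (b + r)) / u"
  proof -
    have "(u - (b - r)) * (u - (b + r)) = u\<^sup>2 - 2 * b * u + b\<^sup>2 - r\<^sup>2"
      by (simp add: algebra_simps power2_eq_square)
    also have "\<dots> = u\<^sup>2 - 2 * b * u - 1"
      using r by simp
    finally show ?thesis
      using u by (simp add: field_simps power2_eq_square)
  qed
  then have "u - 1 / u \<le> 2 * b \<longleftrightarrow> (u - (b - r)) * (u - (b + r)) / u \<le> 0"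
    by linarith
  also have "\<dots> \<longleftrightarrow> u \<le> b - r \<or> 0 < u \<and> u \<le> b + r"
    using u r(2) by (auto simp: divide_le_0_iff mult_le_0_iff zero_le_mult_iff)
  also have "\<dots> \<longleftrightarrow> x \<le> \<beta> + \<alpha> * (b - r) \<or> \<beta> < x \<and> x \<le> \<beta> + \<alpha> * (b + r)"
    using alpha by (simp add: xu zero_less_mult_iff)
  finally show ?thesis .
qed

text \<open>Distribution functions are compared. Up to the null point \<open>\<beta>\<close>, the
  preimage of a ray is the ray and the interval of \<open>boole_map_le_iff\<close>, and their masses
  add up by \<open>arctan_add_conj\<close>.\<close>

lemma distr_boole_map: "distr (cauchy_measure \<alpha> \<beta>) (cauchy_measure \<alpha> \<beta>) (boole_map \<alpha> \<beta>) = cauchy_measure \<alpha> \<beta>"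
proof -
  let ?M = "cauchy_measure \<alpha> \<beta>" and ?T = "boole_map \<alpha> \<beta>"
  interpret prob_space ?M
    by (rule prob_space_cauchy)
  have T [measurable]: "?T \<in> measurable ?M ?M"
    by measurable
  interpret D: prob_space "distr ?M ?M ?T"
    by (rule prob_space_distr) measurable
  show ?thesis
  proof (rule cdf_unique)
    show "real_distribution (distr ?M ?M ?T)" "real_distribution ?M"
      by unfold_locales simp_all
    show "cdf (distr ?M ?M ?T) = cdf ?M"
    proof
      fix a :: real
      define b where "b = (a - \<beta>) / \<alpha>"
      define r where "r = sqrt (b\<^sup>2 + 1)"
      have r: "r > \<bar>b\<bar>"
        by (auto simp: r_def intro: real_less_rsqrt)
      have neg: "\<alpha> * (b - r) < 0" and pos: "\<alpha> * (b + r) > 0"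
        using alpha r by (auto simp: mult_less_0_iff)
      let ?A = "{..\<beta> + \<alpha> * (b - r)}" and ?B = "{\<beta><..\<beta> + \<alpha> * (b + r)}"
      have "cdf (distr ?M ?M ?T) a = prob (?T -` {..a})"
        by (simp add: cdf_def measure_distr)
      also have "\<dots> = prob (?A \<union> ?B)"
      proof (rule measure_eq_AE)
        have "AE x in ?M. x \<noteq> \<beta>"
          using AE_not_in[OF cauchy_singleton[of \<beta>]] by simp
        then show "AE x in ?M. x \<in> ?T -` {..a} \<longleftrightarrow> x \<in> ?A \<union> ?B"
          by eventually_elim (use boole_map_le_iff[of _ a] in \<open>auto simp: b_def r_def\<close>)
        show "?T -` {..a} \<in> sets ?M"
          using measurable_sets[OF T, of "{..a}"] by simp
      qed simp
      also have "\<dots> = prob ?A + prob ?B"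
        using neg by (intro finite_measure_Union) auto
      also have "\<dots> = 1 / 2 + (arctan (b + r) + arctan (b - r)) / pi"
        using pos alpha by (simp add: measure_cauchy_atMost measure_cauchy_Ioc add_divide_distrib)
      also have "\<dots> = cdf ?M a"
        using arctan_add_conj[of b]
        by (simp add: cdf_def measure_cauchy_atMost flip: b_def r_def)
      finally show "cdf (distr ?M ?M ?T) a = cdf ?M a" .
    qed
  qed
qed

section \<open>The circle coordinate and its conjugation of the Boole map to squaring\<close>

lemma Complex_nz: "Complex (x - \<beta>) (- \<alpha>) \<noteq> 0" "Complex (x - \<beta>) \<alpha> \<noteq> 0"
  using alpha by (auto simp: complex_eq_iff)

lemma norm_circle_coord [simp]: "norm (circle_coord \<alpha> \<beta> x) = 1"
proof -
  have "norm (Complex (x - \<beta>) \<alpha>) = norm (Complex (x - \<beta>) (- \<alpha>))"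
    by (simp add: complex_norm)
  then show ?thesis
    using Complex_nz[of x] by (simp add: circle_coord_def norm_divide)
qed

lemma circle_coord_nz [simp]: "circle_coord \<alpha> \<beta> x \<noteq> 0"
  using norm_circle_coord[of x] by (metis norm_zero zero_neq_one)

lemma continuous_circle_coord: "continuous_on UNIV (circle_coord \<alpha> \<beta>)"
  unfolding circle_coord_def Complex_eq using Complex_nz
  by (intro continuous_intros) (auto simp: Complex_eq)

text \<open>Replacing \<open>y = x - \<beta>\<close> by its image turns numerator and denominator
  into their squares divided by \<open>2 * y\<close>, and this factor cancels. At
  \<open>x = \<beta>\<close> the identity fails: the point is fixed by convention, but its
  coordinate is -1.\<close>

lemma circle_coord_boole:
  assumes "x \<noteq> \<beta>"
  shows "circle_coord \<alpha> \<beta> (boole_map \<alpha> \<beta> x) = (circle_coord \<alpha> \<beta> x)\<^sup>2"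
proof -
  define y where "y = x - \<beta>"
  have y: "y \<noteq> 0"
    using assms by (simp add: y_def)
  have T: "boole_map \<alpha> \<beta> x - \<beta> = (y\<^sup>2 - \<alpha>\<^sup>2) / (2 * y)"
    using assms y alpha by (simp add: boole_map_def field_simps y_def power2_eq_square)
  have "Complex ((y\<^sup>2 - \<alpha>\<^sup>2) / (2 * y)) \<alpha> = (Complex y \<alpha>)\<^sup>2 / of_real (2 * y)"
    "Complex ((y\<^sup>2 - \<alpha>\<^sup>2) / (2 * y)) (- \<alpha>) = (Complex y (- \<alpha>))\<^sup>2 / of_real (2 * y)"
    using y by (simp_all add: complex_eq_iff power2_eq_square)
  then show ?thesis
    using y unfolding circle_coord_def T by (simp add: power_divide flip: y_def)
qed

end

subsection \<open>Characters of the circle\<close>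

lemma cnj_eq_inverse:
  assumes "norm z = 1"
  shows "cnj z = inverse z"
proof -
  have "z * cnj z = 1"
    using assms by (simp flip: complex_norm_square)
  then show ?thesis
    by (metis inverse_unique)
qed

text \<open>The functions agreeing on the unit circle with a Laurent polynomial. The rule
  \<open>cong\<close> disregards values off the circle, so that \<open>cnj z\<close> may be
  exchanged for the inverse of \<open>z\<close>.\<close>

inductive laurent_on_circle :: "(complex \<Rightarrow> complex) \<Rightarrow> bool" where
  monom: "laurent_on_circle (\<lambda>z. c * z powi m)"
| add: "laurent_on_circle f \<Longrightarrow> laurent_on_circle g \<Longrightarrow> laurent_on_circle (\<lambda>z. f z + g z)"
| cong: "laurent_on_circle f \<Longrightarrow> (\<And>z. norm z = 1 \<Longrightarrow> f z = g z) \<Longrightarrow> laurent_on_circle g"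

lemma laurent_on_circle_mult:
  assumes "laurent_on_circle f" "laurent_on_circle g"
  shows "laurent_on_circle (\<lambda>z. f z * g z)"
  using assms
proof (induction f)
  case (monom c m)
  then show ?case
  proof (induction g)
    case (monom c' m')
    show ?case
      \<comment> \<open>Exponents of integer powers add for nonzero \<open>z\<close>, hence on the
        circle, and \<open>cong\<close> asks for no more.\<close>
      by (rule laurent_on_circle.cong[OF laurent_on_circle.monom[of "c * c'" "m + m'"]])
         (subst power_int_add, auto)
  next
    case (add f g)
    then show ?case
      using laurent_on_circle.add by (simp add: distrib_left)
  next
    case (cong f g)
    show ?case
      by (rule laurent_on_circle.cong[OF cong.IH]) (simp add: cong.hyps)
  qed
next
  case (add f h)
  then show ?case
    using laurent_on_circle.add by (simp add: distrib_right)
next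
  case (cong f h)
  show ?case
    by (rule laurent_on_circle.cong[OF cong.IH[OF cong.prems]]) (simp add: cong.hyps)
qed

lemma laurent_on_circle_real_polynomial:
  fixes p :: "complex \<Rightarrow> real"
  assumes "real_polynomial_function p"
  shows "laurent_on_circle (\<lambda>z. of_real (p z))"
  using assms
proof (induction p rule: real_polynomial_function.induct)
  case (linear f)
  interpret bounded_linear f
    by (rule linear)
  \<comment> \<open>On the circle \<open>Re z = (z + 1/z) / 2\<close> and
    \<open>Im z = (z - 1/z) / (2 * \<i>)\<close>; \<open>A\<close> and \<open>B\<close> are the
    resulting coefficients of \<open>Re z * f 1 + Im z * f \<i>\<close>.\<close>
  define A where "A = of_real (f 1) / 2 + of_real (f \<i>) / (2 * \<i>)"
  define B where "B = of_real (f 1) / 2 - of_real (f \<i>) / (2 * \<i>)"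
  have "laurent_on_circle (\<lambda>z. A * z powi 1 + B * z powi (- 1))"
    by (intro laurent_on_circle.intros)
  then show ?case
  proof (rule laurent_on_circle.cong)
    fix z :: complex assume z: "norm z = 1"
    have "Re z *\<^sub>R 1 + Im z *\<^sub>R \<i> = z"
      by (simp add: complex_eq_iff)
    then have fz: "f z = Re z * f 1 + Im z * f \<i>"
      using add[of "Re z *\<^sub>R 1" "Im z *\<^sub>R \<i>"] by (simp add: scale)
    have "A * z powi 1 + B * z powi (- 1) = A * z + B * cnj z"
      by (simp add: power_int_minus cnj_eq_inverse[OF z])
    also have "\<dots> = of_real (f z)"
      by (simp add: A_def B_def fz complex_eq_iff field_simps)
    finally show "A * z powi 1 + B * z powi (- 1) = of_real (f z)" .
  qed
next
  case (const c)
  then show ?case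
    using laurent_on_circle.monom[of "of_real c" 0] by simp
qed (auto intro: laurent_on_circle.add laurent_on_circle_mult)

text \<open>Stone-Weierstrass supplies a polynomial in the real and imaginary parts of
  \<open>z\<close>, and on the circle both of these are Laurent polynomials.\<close>

lemma laurent_on_circle_dense:
  assumes "continuous_on (sphere 0 1) H" "\<epsilon> > 0"
  obtains p where "laurent_on_circle p" "\<And>z. norm z = 1 \<Longrightarrow> norm (H z - p z) < \<epsilon>"
proof -
  have "compact (sphere 0 1 :: complex set)"
    by simp
  from Stone_Weierstrass_polynomial_function[OF this assms]
  obtain q where q: "polynomial_function q" "\<forall>z\<in>sphere 0 1. norm (H z - q z) < \<epsilon>"
    by blast
  have "real_polynomial_function (Re \<circ> q)" "real_polynomial_function (Im \<circ> q)"
    using q(1) bounded_linear_Re bounded_linear_Im by (auto simp: polynomial_function_def)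
  then have "laurent_on_circle (\<lambda>z. of_real ((Re \<circ> q) z))" "laurent_on_circle (\<lambda>z. of_real ((Im \<circ> q) z))"
    by (simp_all only: laurent_on_circle_real_polynomial)
  moreover have "laurent_on_circle (\<lambda>z. \<i>)"
    using laurent_on_circle.monom[of \<i> 0] by simp
  ultimately have "laurent_on_circle (\<lambda>z. of_real ((Re \<circ> q) z) + \<i> * of_real ((Im \<circ> q) z))"
    by (intro laurent_on_circle.add laurent_on_circle_mult)
  then have "laurent_on_circle q"
    by (rule laurent_on_circle.cong) (simp add: complex_eq[symmetric])
  with q(2) show thesis
    by (intro that[of q]) auto
qed

section \<open>Approximation by characters of the line and their orthogonality\<close>

context
  fixes \<alpha> \<beta> :: real
  assumes alpha: "\<alpha> > 0"
begin

lemma circle_coord_Re_Im: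
  "Re (circle_coord \<alpha> \<beta> x) = ((x - \<beta>)\<^sup>2 - \<alpha>\<^sup>2) / (\<alpha>\<^sup>2 + (x - \<beta>)\<^sup>2)"
  "Im (circle_coord \<alpha> \<beta> x) = 2 * \<alpha> * (x - \<beta>) / (\<alpha>\<^sup>2 + (x - \<beta>)\<^sup>2)"
  by (simp_all add: circle_coord_def Re_divide Im_divide power2_eq_square add.commute algebra_simps)

lemma laurent_approx:
  fixes h :: "real \<Rightarrow> complex"
  assumes cont: "continuous_on UNIV h" and supp: "\<And>x. \<bar>x\<bar> \<ge> R \<Longrightarrow> h x = 0" and "\<epsilon> > 0"
  obtains p where "laurent_on_circle p" "\<And>x. norm (h x - p (circle_coord \<alpha> \<beta> x)) < \<epsilon>"
proof -
  \<comment> \<open>The inverse of the circle coordinate carries \<open>h\<close> to the circle; the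
    value 0 at the point 1 is the value of \<open>h\<close> near infinity.\<close>
  define H where "H z = (if z = 1 then 0 else h (\<beta> + \<alpha> * Im z / (1 - Re z)))" for z
  have Hw: "H (circle_coord \<alpha> \<beta> x) = h x" for x
  proof -
    define y where "y = x - \<beta>"
    have d: "\<alpha>\<^sup>2 + y\<^sup>2 > 0"
      using cauchy_denom_pos[OF alpha] by (simp add: y_def)
    have 1: "1 - Re (circle_coord \<alpha> \<beta> x) = 2 * \<alpha>\<^sup>2 / (\<alpha>\<^sup>2 + y\<^sup>2)"
      using d alpha by (simp add: circle_coord_Re_Im y_def[symmetric] diff_eq_eq flip: add_divide_distrib)
    also have "\<dots> > 0"
      using d alpha by simp
    finally have "circle_coord \<alpha> \<beta> x \<noteq> 1"
      by auto
    moreover have "\<alpha> * Im (circle_coord \<alpha> \<beta> x) / (1 - Re (circle_coord \<alpha> \<beta> x)) = y"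
      unfolding 1 using d alpha by (simp add: circle_coord_Re_Im y_def[symmetric] power2_eq_square)
    ultimately show ?thesis
      by (simp add: H_def y_def)
  qed
  have Re_lt: "Re z < 1" if "norm z = 1" "z \<noteq> 1" for z
  proof -
    have "Re z \<le> 1"
      using complex_Re_le_cmod[of z] that by simp
    moreover have "Re z \<noteq> 1"
      using that cmod_eq_Re[of z] by (auto simp: complex_eq_iff cmod_def)
    ultimately show ?thesis
      by simp
  qed
  have "continuous_on (sphere 0 1) H"
    unfolding continuous_on_def
  proof
    fix z :: complex assume "z \<in> sphere 0 1"
    then have z: "norm z = 1"
      by simp
    show "(H \<longlongrightarrow> H z) (at z within sphere 0 1)"
    proof (cases "z = 1")
      case True
      \<comment> \<open>Near 1 the line coordinate \<open>y\<close> satisfies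
        \<open>y^2 * (1 - Re z) = \<alpha>^2 * (1 + Re z)\<close>. With \<open>Re z > 0\<close> and
        \<open>1 - Re z < \<alpha>^2 / Q\<close> this gives \<open>y^2 > Q\<close>, so
        \<open>\<beta> + y\<close> lies outside the support of \<open>h\<close>.\<close>
      define Q where "Q = (\<bar>R\<bar> + \<bar>\<beta>\<bar> + 1)\<^sup>2"
      have Q: "Q > 0"
        by (simp add: Q_def add_nonneg_pos)
      have "(Re \<longlongrightarrow> Re 1) (at 1 within sphere 0 1)"
        by (intro tendsto_intros)
      then have "\<forall>\<^sub>F z in at 1 within sphere 0 1. Re z > max 0 (1 - \<alpha>\<^sup>2 / Q)"
        by (rule order_tendstoD(1)) (use Q alpha in auto)
      moreover have "\<forall>\<^sub>F z in at 1 within sphere 0 1. norm z = 1 \<and> z \<noteq> (1::complex)"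
        by (auto simp: eventually_at_filter)
      ultimately have "\<forall>\<^sub>F z in at 1 within sphere 0 1. H z = 0"
      proof eventually_elim
        case (elim z)
        define y where "y = \<alpha> * Im z / (1 - Re z)"
        have lt: "Re z < 1"
          using Re_lt elim by simp
        have "(Im z)\<^sup>2 = (1 - Re z) * (1 + Re z)"
          using elim cmod_power2[of z] by (simp add: power2_eq_square algebra_simps)
        then have "y\<^sup>2 * (1 - Re z) = \<alpha>\<^sup>2 * (1 + Re z)"
          using lt by (simp add: y_def power_mult_distrib power_divide power2_eq_square[of "1 - Re z"])
        also have "\<dots> \<ge> \<alpha>\<^sup>2 * 1"
          using elim by (intro mult_left_mono) auto
        finally have "\<alpha>\<^sup>2 \<le> y\<^sup>2 * (1 - Re z)"
          by simp
        moreover have "Q * (1 - Re z) < \<alpha>\<^sup>2"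
        proof -
          have "1 - Re z < \<alpha>\<^sup>2 / Q"
            using elim by simp
          then show ?thesis
            using Q by (simp add: field_simps)
        qed
        ultimately have "Q * (1 - Re z) < y\<^sup>2 * (1 - Re z)"
          by linarith
        then have "Q < y\<^sup>2"
          using lt by simp
        then have "(\<bar>R\<bar> + \<bar>\<beta>\<bar> + 1)\<^sup>2 < \<bar>y\<bar>\<^sup>2"
          by (simp add: Q_def)
        then have "\<bar>R\<bar> + \<bar>\<beta>\<bar> + 1 < \<bar>y\<bar>"
          by (rule power2_less_imp_less) simp
        then have "\<bar>\<beta> + y\<bar> \<ge> R"
          by linarith
        then show ?case
          using supp by (simp add: H_def y_def)
      qed
      then show ?thesis
        using True by (auto simp: H_def intro: tendsto_eventually)
    next
      case False
      have "isCont (\<lambda>z. h (\<beta> + \<alpha> * Im z / (1 - Re z))) z"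
      proof (rule isCont_o2[where f = "\<lambda>z. \<beta> + \<alpha> * Im z / (1 - Re z)" and g = h])
        show "isCont (\<lambda>z. \<beta> + \<alpha> * Im z / (1 - Re z)) z"
          using Re_lt[OF z False] by (intro continuous_intros) auto
      qed (use cont in \<open>simp add: continuous_on_eq_continuous_at\<close>)
      then have "((\<lambda>z. h (\<beta> + \<alpha> * Im z / (1 - Re z))) \<longlongrightarrow> H z) (at z within sphere 0 1)"
        using False by (auto simp: isCont_def H_def intro: tendsto_within_subset)
      moreover have "\<forall>\<^sub>F w in at z within sphere 0 1. h (\<beta> + \<alpha> * Im w / (1 - Re w)) = H w"
        unfolding eventually_at_filter
        by (rule eventually_mono[OF t1_space_nhds[OF False]]) (simp add: H_def)
      ultimately show ?thesis
        by (rule Lim_transform_eventually)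
    qed
  qed
  then obtain p where "laurent_on_circle p" "\<And>z. norm z = 1 \<Longrightarrow> norm (H z - p z) < \<epsilon>"
    using laurent_on_circle_dense \<open>\<epsilon> > 0\<close> by blast
  then show thesis
    using that[of p] Hw norm_circle_coord[OF alpha] by metis
qed

text \<open>The logarithmic derivative of the circle coordinate is \<open>- 2 * pi * \<i>\<close>
  times the Cauchy density. Hence a nontrivial character times the density has a multiple of the
  character as antiderivative.\<close>

lemma DERIV_circle_powi:
  "((\<lambda>x. circle_coord \<alpha> \<beta> x powi m) has_vector_derivative
     (- (2 * pi * \<i> * of_int m)) * (cauchy_density \<alpha> \<beta> x *\<^sub>R circle_coord \<alpha> \<beta> x powi m)) (at x)"
proof -
  \<comment> \<open>Extending the coordinate to a complex variable makes the field derivative of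
    integer powers available; the result is then restricted to the real line.\<close>
  define W where "W z = (z - \<beta> + \<i> * \<alpha>) / (z - \<beta> - \<i> * \<alpha>)" for z :: complex
  have W: "W (of_real x) = circle_coord \<alpha> \<beta> x" for x
    by (simp add: W_def circle_coord_def Complex_eq)
  have nz: "of_real x - of_real \<beta> - \<i> * of_real \<alpha> \<noteq> 0" "of_real x - of_real \<beta> + \<i> * of_real \<alpha> \<noteq> (0::complex)"
    using alpha by (auto simp: complex_eq_iff)
  have Wx: "W (of_real x) \<noteq> 0"
    using nz by (simp add: W_def)
  let ?d = "- (2 * \<i> * \<alpha>) / (of_real x - of_real \<beta> - \<i> * \<alpha>)\<^sup>2 :: complex"
  have "(W has_field_derivative ?d) (at (of_real x))"
    unfolding W_def using nz
    by (auto intro!: derivative_eq_intros simp: power2_eq_square divide_simps algebra_simps)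
  from DERIV_power_int[OF this disjI2[OF Wx], of m]
  have "((\<lambda>z. W z powi m) has_field_derivative of_int m * W (of_real x) powi (m - 1) * ?d) (at (of_real x))" .
  then have "((\<lambda>x. W (of_real x) powi m) has_vector_derivative of_int m * W (of_real x) powi (m - 1) * ?d) (at x)"
    by (rule has_vector_derivative_real_field)
  moreover have "of_int m * W (of_real x) powi (m - 1) * ?d
      = (- (2 * pi * \<i> * of_int m)) * (cauchy_density \<alpha> \<beta> x *\<^sub>R W (of_real x) powi m)"
  proof -
    have "?d = W (of_real x) * (- (2 * pi * \<i>) * of_real (cauchy_density \<alpha> \<beta> x))"
    proof -
      have "complex_of_real (\<alpha>\<^sup>2 + (x - \<beta>)\<^sup>2) =
        (of_real x - of_real \<beta> + \<i> * of_real \<alpha>) * (of_real x - of_real \<beta> - \<i> * of_real \<alpha>)"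
        by (simp add: complex_eq_iff power2_eq_square)
      then have "complex_of_real (cauchy_density \<alpha> \<beta> x) =
        of_real \<alpha> / of_real pi / ((of_real x - of_real \<beta> + \<i> * of_real \<alpha>) * (of_real x - of_real \<beta> - \<i> * of_real \<alpha>))"
        unfolding cauchy_density_def of_real_divide by simp
      then show ?thesis
        using nz by (simp add: W_def power2_eq_square)
    qed
    moreover have "W (of_real x) powi m = W (of_real x) powi (m - 1) * W (of_real x)"
      using Wx power_int_add[of "W (of_real x)" "m - 1" 1] by simp
    ultimately show ?thesis
      by (simp add: scaleR_conv_of_real mult_ac)
  qed
  ultimately show ?thesis
    by (simp add: W)
qed

text \<open>The difference from 1 is
  \<open>2 * \<i> * \<alpha> / (x - \<beta> - \<i> * \<alpha>)\<close>. A general filter covers both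
  ends of the line at once.\<close>

lemma circle_coord_tendsto:
  assumes F: "filterlim (\<lambda>x::real. \<bar>x\<bar>) at_top F"
  shows "((\<lambda>x. circle_coord \<alpha> \<beta> x powi m) \<longlongrightarrow> 1) F"
proof -
  have "((\<lambda>x. circle_coord \<alpha> \<beta> x - 1) \<longlongrightarrow> 0) F"
  proof (rule Lim_null_comparison)
    have "norm (circle_coord \<alpha> \<beta> x - 1) \<le> 2 * \<alpha> / (\<bar>x\<bar> - \<bar>\<beta>\<bar>)" if "\<bar>x\<bar> > \<bar>\<beta>\<bar>" for x
    proof -
      have "circle_coord \<alpha> \<beta> x - 1 = 2 * \<i> * \<alpha> / Complex (x - \<beta>) (- \<alpha>)"
      proof -
        have "circle_coord \<alpha> \<beta> x - 1 = (Complex (x - \<beta>) \<alpha> - Complex (x - \<beta>) (- \<alpha>)) / Complex (x - \<beta>) (- \<alpha>)"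
          using Complex_nz[OF alpha, of x \<beta>] by (simp add: circle_coord_def diff_divide_distrib)
        also have "Complex (x - \<beta>) \<alpha> - Complex (x - \<beta>) (- \<alpha>) = 2 * \<i> * \<alpha>"
          by (simp add: complex_eq_iff)
        finally show ?thesis .
      qed
      also have "norm \<dots> = 2 * \<alpha> / norm (Complex (x - \<beta>) (- \<alpha>))"
        using alpha by (simp add: norm_divide norm_mult)
      also have "\<dots> \<le> 2 * \<alpha> / (\<bar>x\<bar> - \<bar>\<beta>\<bar>)"
        using alpha that abs_Re_le_cmod[of "Complex (x - \<beta>) (- \<alpha>)"]
        by (intro divide_left_mono mult_pos_pos) auto
      finally show ?thesis .
    qed
    moreover have "\<forall>\<^sub>F x in F. \<bar>x\<bar> > \<bar>\<beta>\<bar>"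
      using F by (auto simp: filterlim_at_top_dense)
    ultimately show "\<forall>\<^sub>F x in F. norm (circle_coord \<alpha> \<beta> x - 1) \<le> 2 * \<alpha> / (\<bar>x\<bar> - \<bar>\<beta>\<bar>)"
      by (auto elim: eventually_mono)
    have "((\<lambda>y. 2 * \<alpha> / (y - \<bar>\<beta>\<bar>)) \<longlongrightarrow> 0) at_top"
      by real_asymp
    then show "((\<lambda>x. 2 * \<alpha> / (\<bar>x\<bar> - \<bar>\<beta>\<bar>)) \<longlongrightarrow> 0) F"
      using F by (rule filterlim_compose)
  qed
  then have "(circle_coord \<alpha> \<beta> \<longlongrightarrow> 1) F"
    by (simp add: LIM_zero_iff)
  then show ?thesis
    using tendsto_power_int[of "circle_coord \<alpha> \<beta>" 1 F m] by simp
qed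

lemma continuous_circle_powi: "continuous_on UNIV (\<lambda>x. circle_coord \<alpha> \<beta> x powi m)"
  using continuous_circle_coord[OF alpha] circle_coord_nz[OF alpha]
  by (intro continuous_intros) auto

lemma borel_circle_coord [measurable]: "circle_coord \<alpha> \<beta> \<in> borel_measurable borel"
  using continuous_circle_coord[OF alpha] by (rule borel_measurable_continuous_onI)

lemma borel_circle_powi [measurable]: "(\<lambda>x. circle_coord \<alpha> \<beta> x powi m) \<in> borel_measurable borel"
  using continuous_circle_powi by (rule borel_measurable_continuous_onI)

lemma norm_circle_powi: "norm (circle_coord \<alpha> \<beta> x powi m) = 1"
  by (simp add: norm_power_int alpha)

lemma integrable_circle_powi: "integrable (cauchy_measure \<alpha> \<beta>) (\<lambda>x. circle_coord \<alpha> \<beta> x powi m)"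
proof -
  interpret prob_space "cauchy_measure \<alpha> \<beta>"
    by (rule prob_space_cauchy[OF alpha])
  show ?thesis
    by (rule integrable_const_bound[of _ 1]) (auto simp: norm_circle_powi)
qed

text \<open>For \<open>m \<noteq> 0\<close> the antiderivative has the same limit at both ends of
  the line, so the integral vanishes.\<close>

lemma integral_circle_powi:
  "(LINT x|cauchy_measure \<alpha> \<beta>. circle_coord \<alpha> \<beta> x powi m) = (if m = 0 then 1 else 0)"
proof (cases "m = 0")
  case True
  interpret prob_space "cauchy_measure \<alpha> \<beta>"
    by (rule prob_space_cauchy[OF alpha])
  show ?thesis
    using True prob_space by simp
next
  case False
  let ?f = "\<lambda>x. cauchy_density \<alpha> \<beta> x *\<^sub>R circle_coord \<alpha> \<beta> x powi m"
  let ?c = "- (2 * pi * \<i> * of_int m) :: complex"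
  let ?F = "\<lambda>x. inverse ?c * circle_coord \<alpha> \<beta> x powi m"
  have c: "?c \<noteq> 0"
    using False by simp
  have I: "integrable lborel ?f"
    using integrable_circle_powi by (subst (asm) integrable_cauchy_iff[OF alpha]) auto
  have "(LBINT x=-\<infinity>..\<infinity>. ?f x) = inverse ?c * 1 - inverse ?c * 1"
  proof (rule interval_integral_FTC_integrable)
    fix x
    show "(?F has_vector_derivative ?f x) (at x)"
      using has_vector_derivative_mult_right[OF DERIV_circle_powi, of "inverse ?c" m x] c
      by (simp only: mult.assoc[symmetric] left_inverse[OF c] mult_1_left)
    show "isCont ?f x"
      using isCont_cauchy_density[OF alpha] continuous_circle_powi[of m]
      by (intro isCont_scaleR) (auto simp: continuous_on_eq_continuous_at)
    show "set_integrable lborel (einterval (-\<infinity>) \<infinity>) ?f"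
      using I by (simp add: set_integrable_def)
    have "filterlim (\<lambda>x::real. \<bar>x\<bar>) at_top at_bot" "filterlim (\<lambda>x::real. \<bar>x\<bar>) at_top at_top"
      by real_asymp+
    then show "((?F \<circ> real_of_ereal) \<longlongrightarrow> inverse ?c * 1) (at_right (-\<infinity>))"
      "((?F \<circ> real_of_ereal) \<longlongrightarrow> inverse ?c * 1) (at_left \<infinity>)"
      unfolding ereal_tendsto_simps by (simp_all only: tendsto_mult_left circle_coord_tendsto)
  qed simp
  then have "(LINT x|lborel. ?f x) = 0"
    by (simp add: interval_lebesgue_integral_def set_lebesgue_integral_def)
  then show ?thesis
    using False by (simp add: integral_cauchy[OF alpha])
qed

text \<open>The exponents \<open>m * 2 ^ d\<close> are pairwise distinct, so all off-diagonal terms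
  of the expanded square integrate to 0 and each of the \<open>N\<close> diagonal terms to
  1.\<close>

lemma integral_norm_square_lacunary:
  assumes m: "m \<noteq> 0"
  shows "(LINT x|cauchy_measure \<alpha> \<beta>. (norm (\<Sum>d<N. circle_coord \<alpha> \<beta> x powi (m * 2 ^ d)))\<^sup>2) = real N"
proof -
  let ?w = "circle_coord \<alpha> \<beta>"
  have sq: "complex_of_real ((norm (\<Sum>d<N. ?w x powi (m * 2 ^ d)))\<^sup>2)
      = (\<Sum>d<N. \<Sum>e<N. ?w x powi (m * 2 ^ d - m * 2 ^ e))" for x
  proof -
    have w: "cnj (?w x) = inverse (?w x)"
      by (rule cnj_eq_inverse[OF norm_circle_coord[OF alpha]])
    have "complex_of_real ((norm (\<Sum>d<N. ?w x powi (m * 2 ^ d)))\<^sup>2)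
        = (\<Sum>d<N. ?w x powi (m * 2 ^ d)) * (\<Sum>e<N. cnj (?w x powi (m * 2 ^ e)))"
      by (simp only: complex_norm_square cnj_sum)
    also have "\<dots> = (\<Sum>d<N. \<Sum>e<N. ?w x powi (m * 2 ^ d) * cnj (?w x powi (m * 2 ^ e)))"
      by (rule sum_product)
    also have "\<dots> = (\<Sum>d<N. \<Sum>e<N. ?w x powi (m * 2 ^ d - m * 2 ^ e))"
    proof (intro sum.cong refl)
      fix d e
      have "cnj (?w x powi (m * 2 ^ e)) = ?w x powi (- (m * 2 ^ e))"
        by (simp only: complex_cnj_power_int w power_int_inverse power_int_minus)
      moreover have "?w x powi (m * 2 ^ d + - (m * 2 ^ e)) = ?w x powi (m * 2 ^ d) * ?w x powi (- (m * 2 ^ e))"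
        by (rule power_int_add) (simp add: circle_coord_nz[OF alpha])
      ultimately show "?w x powi (m * 2 ^ d) * cnj (?w x powi (m * 2 ^ e)) = ?w x powi (m * 2 ^ d - m * 2 ^ e)"
        by (simp only: diff_conv_add_uminus)
    qed
    finally show ?thesis .
  qed
  have "complex_of_real (LINT x|cauchy_measure \<alpha> \<beta>. (norm (\<Sum>d<N. ?w x powi (m * 2 ^ d)))\<^sup>2)
      = (LINT x|cauchy_measure \<alpha> \<beta>. complex_of_real ((norm (\<Sum>d<N. ?w x powi (m * 2 ^ d)))\<^sup>2))"
    by (rule integral_complex_of_real[symmetric])
  also have "\<dots> = (LINT x|cauchy_measure \<alpha> \<beta>. (\<Sum>d<N. \<Sum>e<N. ?w x powi (m * 2 ^ d - m * 2 ^ e)))"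
    by (simp only: sq)
  also have "\<dots> = (\<Sum>d<N. \<Sum>e<N. (LINT x|cauchy_measure \<alpha> \<beta>. ?w x powi (m * 2 ^ d - m * 2 ^ e)))"
    by (simp add: integrable_circle_powi)
  also have "\<dots> = (\<Sum>d<N. \<Sum>e<N. if d = e then 1 else 0)"
  proof (intro sum.cong refl)
    fix d e :: nat
    have "m * 2 ^ d - m * 2 ^ e = 0 \<longleftrightarrow> d = e"
      using m by simp
    then show "(LINT x|cauchy_measure \<alpha> \<beta>. ?w x powi (m * 2 ^ d - m * 2 ^ e)) = (if d = e then 1 else 0)"
      by (simp only: integral_circle_powi)
  qed
  also have "\<dots> = of_real (real N)"
    by simp
  finally show ?thesis
    by (simp only: of_real_eq_iff)
qed

lemma measure_preserving_boole: "measure_preserving (cauchy_measure \<alpha> \<beta>) (boole_map \<alpha> \<beta>)"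
proof -
  interpret prob_space "cauchy_measure \<alpha> \<beta>"
    by (rule prob_space_cauchy[OF alpha])
  show ?thesis
    by unfold_locales (auto simp: distr_boole_map[OF alpha])
qed

text \<open>Squaring can be iterated along orbits that avoid \<open>\<beta>\<close>; preservation of
  the measure keeps the exceptional set null at each step.\<close>

lemma AE_circle_coord_funpow:
  "AE x in cauchy_measure \<alpha> \<beta>. circle_coord \<alpha> \<beta> ((boole_map \<alpha> \<beta> ^^ d) x) = circle_coord \<alpha> \<beta> x ^ (2 ^ d)"
proof -
  interpret measure_preserving "cauchy_measure \<alpha> \<beta>" "boole_map \<alpha> \<beta>"
    by (rule measure_preserving_boole)
  show ?thesis
  proof (induction d)
    case (Suc d)
    have "AE x in cauchy_measure \<alpha> \<beta>. x \<noteq> \<beta>"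
      using AE_not_in[OF cauchy_singleton[OF alpha, of \<beta> \<beta>]] by simp
    then show ?case
      using AE_map[OF Suc]
    proof eventually_elim
      case (elim x)
      then show ?case
        by (simp add: funpow_swap1 circle_coord_boole[OF alpha] power_mult[symmetric])
    qed
  qed simp
qed

section \<open>From characters to all continuous integrable functions\<close>

context
  fixes n k :: "nat \<Rightarrow> nat"
  assumes stoltz: "stoltz n k"
begin

interpretation stoltz_averages "cauchy_measure \<alpha> \<beta>" "boole_map \<alpha> \<beta>" n k
  using measure_preserving_boole stoltz
  by (intro stoltz_averages.intro stoltz_averages_axioms.intro)

lemma good_character: "good (\<lambda>x. circle_coord \<alpha> \<beta> x powi m)"
proof (cases "m = 0")
  case True
  then show ?thesis
    using good_const[of 1] by simp
next
  case False
  let ?w = "circle_coord \<alpha> \<beta>"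
  show ?thesis
  proof (rule good_of_mean_ergodic)
    show "norm (?w x powi m) \<le> 1" for x
      by (simp add: norm_circle_powi)
    let ?I = "\<lambda>N. LINT x|cauchy_measure \<alpha> \<beta>. norm (1 / of_nat (Suc N) * (\<Sum>d<Suc N. ?w ((boole_map \<alpha> \<beta> ^^ d) x) powi m))"
    have bound: "?I N \<le> 1 / sqrt (real (Suc N))" for N
    proof -
      define s where "s = sqrt (real (Suc N))"
      have s: "s > 0" "s * s = real (Suc N)"
        by (auto simp: s_def)
      let ?S = "\<lambda>x. \<Sum>d<Suc N. ?w x powi (m * 2 ^ d)"
      have nS: "norm (?S x) \<le> real (Suc N)" for x
        using norm_sum[of "\<lambda>d. ?w x powi (m * 2 ^ d)" "{..<Suc N}"] by (simp add: norm_circle_powi)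
      have int2: "integrable (cauchy_measure \<alpha> \<beta>) (\<lambda>x. (norm (?S x))\<^sup>2)"
        by (rule integrable_const_bound[of _ "(real (Suc N))\<^sup>2"]) (use nS in \<open>auto intro!: power_mono simp del: of_nat_Suc sum.lessThan_Suc\<close>)
      have "AE x in cauchy_measure \<alpha> \<beta>. \<forall>d. ?w ((boole_map \<alpha> \<beta> ^^ d) x) = ?w x ^ (2 ^ d)"
        using AE_circle_coord_funpow by (simp add: AE_all_countable)
      then have "?I N = (LINT x|cauchy_measure \<alpha> \<beta>. norm (1 / of_nat (Suc N) * ?S x))"
      proof (intro integral_cong_AE)
        assume "AE x in cauchy_measure \<alpha> \<beta>. \<forall>d. ?w ((boole_map \<alpha> \<beta> ^^ d) x) = ?w x ^ (2 ^ d)"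
        then show "AE x in cauchy_measure \<alpha> \<beta>.
            norm (1 / of_nat (Suc N) * (\<Sum>d<Suc N. ?w ((boole_map \<alpha> \<beta> ^^ d) x) powi m))
            = norm (1 / of_nat (Suc N) * ?S x)"
        proof eventually_elim
          case (elim x)
          have "?w ((boole_map \<alpha> \<beta> ^^ d) x) powi m = ?w x powi (m * 2 ^ d)" for d
          proof -
            have "?w x powi (m * 2 ^ d) = (?w x powi int (2 ^ d)) powi m"
              by (simp add: power_int_mult mult.commute[of m])
            then show ?thesis
              using elim by (simp only: power_int_of_nat)
          qed
          then show ?case
            by (simp only:)
        qed
      qed measurable
      \<comment> \<open>The inequality \<open>(t / s - 1)^2 \<ge> 0\<close> replaces Cauchy-Schwarz.
        Since the mean square of \<open>?S\<close> is \<open>Suc N = s * s\<close>, both summands on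
        the right integrate to \<open>1 / s\<close>.\<close>
      also have "\<dots> \<le> (LINT x|cauchy_measure \<alpha> \<beta>. ((norm (?S x))\<^sup>2 / (s * s * s) + 1 / s) / 2)"
      proof (rule integral_mono)
        show "integrable (cauchy_measure \<alpha> \<beta>) (\<lambda>x. norm (1 / of_nat (Suc N) * ?S x))"
          by (intro integrable_norm integrable_mult_right Bochner_Integration.integrable_sum integrable_circle_powi)
        show "integrable (cauchy_measure \<alpha> \<beta>) (\<lambda>x. ((norm (?S x))\<^sup>2 / (s * s * s) + 1 / s) / 2)"
          using int2 by (intro Bochner_Integration.integrable_add integrable_divide) auto
        fix x
        define t where "t = norm (?S x)"
        have "0 \<le> (t / s - 1)\<^sup>2 / s"
          using s by simp
        also have "(t / s - 1)\<^sup>2 / s = t\<^sup>2 / (s * s * s) + 1 / s - 2 * (t / (s * s))"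
          using s(1) by (simp add: power2_eq_square field_simps)
        finally have "t / (s * s) \<le> (t\<^sup>2 / (s * s * s) + 1 / s) / 2"
          by (simp add: mult.commute)
        then show "norm (1 / of_nat (Suc N) * ?S x) \<le> ((norm (?S x))\<^sup>2 / (s * s * s) + 1 / s) / 2"
          by (simp add: t_def s(2) norm_mult norm_divide del: of_nat_Suc sum.lessThan_Suc)
      qed
      also have "\<dots> = (real (Suc N) / (s * s * s) + 1 / s) / 2"
        using int2 prob_space integral_norm_square_lacunary[OF False, of "Suc N"]
        by (simp del: of_nat_Suc sum.lessThan_Suc)
      also have "\<dots> = 1 / s"
        unfolding s(2)[symmetric] using s(1) by simp
      finally show ?thesis
        by (simp only: s_def)
    qed
    have "?I N \<ge> 0" for N
      by (rule Bochner_Integration.integral_nonneg) (rule norm_ge_zero)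
    with bound have "norm (?I N) \<le> 1 / sqrt (real (Suc N))" for N
      by (simp only: real_norm_def abs_of_nonneg)
    moreover have "(\<lambda>N. 1 / sqrt (real (Suc N))) \<longlonglongrightarrow> 0"
      by real_asymp
    ultimately show "?I \<longlonglongrightarrow> 0"
      by (rule Lim_null_comparison[OF always_eventually[OF allI]])
  qed measurable
qed

lemma good_laurent: "laurent_on_circle p \<Longrightarrow> good (\<lambda>x. p (circle_coord \<alpha> \<beta> x))"
proof (induction rule: laurent_on_circle.induct)
  case (cong f g)
  then show ?case
    by (simp add: alpha)
qed (auto intro: good_cmult good_character good_add)

text \<open>Uniform approximation by Laurent polynomials in the circle coordinate is approximation
  in mean, the measure being a probability.\<close>

lemma good_compact_support:
  assumes cont: "continuous_on UNIV h" and supp: "\<And>x. \<bar>x\<bar> \<ge> R \<Longrightarrow> h x = 0"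
  shows "good h"
proof (rule good_limit)
  have [measurable]: "h \<in> borel_measurable borel"
    using cont by (rule borel_measurable_continuous_onI)
  have "bounded (h ` {- R..R})"
    using cont continuous_on_subset by (intro compact_imp_bounded compact_continuous_image) blast+
  then obtain B where "\<forall>y\<in>h ` {- R..R}. norm y \<le> B"
    unfolding bounded_iff by blast
  then have B: "norm (h x) \<le> B" if "x \<in> {- R..R}" for x
    using that by blast
  \<comment> \<open>For negative \<open>R\<close> the interval is empty and \<open>B\<close> may be
    negative, hence the maximum with 0.\<close>
  have "norm (h x) \<le> max B 0" for x
    using B[of x] supp[of x] by (cases "\<bar>x\<bar> \<ge> R") force+
  then show "integrable (cauchy_measure \<alpha> \<beta>) h"
    by (intro integrable_const_bound[of _ "max B 0"]) auto
  fix \<epsilon> :: real assume "\<epsilon> > 0"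
  then obtain p where p: "laurent_on_circle p" "\<And>x. norm (h x - p (circle_coord \<alpha> \<beta> x)) < \<epsilon> / 2"
    using laurent_approx[OF cont supp] by (metis half_gt_zero)
  have gp: "good (\<lambda>x. p (circle_coord \<alpha> \<beta> x))"
    using p(1) by (rule good_laurent)
  have "(LINT x|cauchy_measure \<alpha> \<beta>. norm (h x - p (circle_coord \<alpha> \<beta> x))) \<le> (LINT x|cauchy_measure \<alpha> \<beta>. \<epsilon> / 2)"
    using p(2) good_integrable[OF gp] \<open>integrable _ h\<close> by (intro integral_mono) (auto intro: less_imp_le)
  also have "\<dots> < \<epsilon>"
    using prob_space \<open>\<epsilon> > 0\<close> by simp
  finally show "\<exists>h'. good h' \<and> (LINT x|cauchy_measure \<alpha> \<beta>. norm (h x - h' x)) < \<epsilon>"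
    using gp by blast
qed

lemma good_continuous:
  assumes cont: "continuous_on UNIV h" and int_h: "integrable (cauchy_measure \<alpha> \<beta>) h"
  shows "good h"
proof (rule good_limit[OF int_h])
  fix \<epsilon> :: real assume "\<epsilon> > 0"
  \<comment> \<open>A trapezoidal cutoff, equal to 1 on \<open>{-N..N}\<close> and to 0 outside
    \<open>{-N-1..N+1}\<close>. Dominated convergence then gives approximation in mean.\<close>
  define b :: "nat \<Rightarrow> real \<Rightarrow> real" where "b N x = max 0 (min 1 (real N + 1 - \<bar>x\<bar>))" for N x
  have b: "0 \<le> b N x" "b N x \<le> 1" for N x
    by (auto simp: b_def)
  have [measurable]: "h \<in> borel_measurable borel"
    using cont by (rule borel_measurable_continuous_onI)
  have [measurable]: "b N \<in> borel_measurable borel" for N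
    unfolding b_def by measurable
  have "(\<lambda>N. LINT x|cauchy_measure \<alpha> \<beta>. norm (h x - of_real (b N x) * h x)) \<longlonglongrightarrow> (LINT x|cauchy_measure \<alpha> \<beta>. 0)"
  proof (rule integral_dominated_convergence[where w = "\<lambda>x. norm (h x)"])
    show "AE x in cauchy_measure \<alpha> \<beta>. (\<lambda>N. norm (h x - of_real (b N x) * h x)) \<longlonglongrightarrow> 0"
    proof (intro AE_I2 tendsto_eventually)
      fix x
      show "\<forall>\<^sub>F N in sequentially. norm (h x - of_real (b N x) * h x) = 0"
        using eventually_ge_at_top[of "nat \<lceil>\<bar>x\<bar>\<rceil>"]
      proof eventually_elim
        case (elim N)
        then have "\<bar>x\<bar> \<le> real N"
          by linarith
        then show ?case
          by (simp add: b_def)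
      qed
    qed
    show "AE x in cauchy_measure \<alpha> \<beta>. norm (norm (h x - of_real (b N x) * h x)) \<le> norm (h x)" for N
    proof (rule AE_I2)
      fix x
      have "h x - of_real (b N x) * h x = of_real (1 - b N x) * h x"
        by (simp add: algebra_simps)
      then show "norm (norm (h x - of_real (b N x) * h x)) \<le> norm (h x)"
        using b[of N x] by (simp add: norm_mult mult_left_le_one_le del: of_real_diff)
    qed
  qed (use int_h in auto)
  then have "\<forall>\<^sub>F N in sequentially. (LINT x|cauchy_measure \<alpha> \<beta>. norm (h x - of_real (b N x) * h x)) < \<epsilon>"
    using \<open>\<epsilon> > 0\<close> by (auto intro: order_tendstoD(2))
  then obtain N where N: "(LINT x|cauchy_measure \<alpha> \<beta>. norm (h x - of_real (b N x) * h x)) < \<epsilon>"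
    by (auto simp: eventually_sequentially)
  have "good (\<lambda>x. of_real (b N x) * h x)"
  proof (rule good_compact_support[where R = "real N + 1"])
    show "continuous_on UNIV (\<lambda>x. of_real (b N x) * h x)"
      unfolding b_def using cont by (intro continuous_intros)
  qed (auto simp: b_def)
  with N show "\<exists>h'. good h' \<and> (LINT x|cauchy_measure \<alpha> \<beta>. norm (h x - h' x)) < \<epsilon>"
    by blast
qed

text \<open>The result for good functions is restated with Lebesgue measure and an explicit kernel,
  in the form used on vertical lines.\<close>

lemma moving_averages_boole:
  fixes h :: "real \<Rightarrow> complex"
  assumes cont: "continuous_on UNIV h"
    and int_h: "integrable lborel (\<lambda>x. h x / of_real (\<alpha>\<^sup>2 + (x - \<beta>)\<^sup>2))"
  shows "AE x in lborel. (\<lambda>l. 1 / of_nat (k l) * (\<Sum>j=1..k l. h ((boole_map \<alpha> \<beta> ^^ (n l + j)) x)))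
    \<longlonglongrightarrow> of_real (\<alpha> / pi) * (LINT x|lborel. h x / of_real (\<alpha>\<^sup>2 + (x - \<beta>)\<^sup>2))"
proof -
  have [measurable]: "h \<in> borel_measurable borel"
    using cont by (rule borel_measurable_continuous_onI)
  have eq: "cauchy_density \<alpha> \<beta> x *\<^sub>R h x = of_real (\<alpha> / pi) * (h x / of_real (\<alpha>\<^sup>2 + (x - \<beta>)\<^sup>2))" for x
    unfolding cauchy_density_def scaleR_conv_of_real of_real_divide by simp
  have "integrable (cauchy_measure \<alpha> \<beta>) h"
    unfolding integrable_cauchy_iff[OF alpha \<open>h \<in> borel_measurable borel\<close>] eq
    using int_h by (rule integrable_mult_right)
  then have "good h"
    by (rule good_continuous[OF cont])
  moreover have "(LINT x|cauchy_measure \<alpha> \<beta>. h x) = of_real (\<alpha> / pi) * (LINT x|lborel. h x / of_real (\<alpha>\<^sup>2 + (x - \<beta>)\<^sup>2))"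
    unfolding integral_cauchy[OF alpha \<open>h \<in> borel_measurable borel\<close>] eq
    by (rule integral_mult_right_zero)
  ultimately show ?thesis
    unfolding good_def AE_cauchy_iff[OF alpha] avg_def by simp
qed

end

end

subsection \<open>Integrability on vertical lines\<close>

lemma set_integrable_powr_at_top:
  fixes a R :: real
  assumes a: "a < -1" and R: "R > 0"
  shows "set_integrable lborel {R<..} (\<lambda>t. t powr a)"
proof -
  have lim: "((\<lambda>t. t powr (a + 1) / (a + 1)) \<longlongrightarrow> 0) at_top"
    using tendsto_divide[OF tendsto_neg_powr[of "a + 1" "\<lambda>t. t" at_top] tendsto_const[of "a + 1"]] a
    by (simp add: filterlim_ident)
  have "((\<lambda>t. t powr (a + 1) / (a + 1)) \<longlongrightarrow> R powr (a + 1) / (a + 1)) (at_right R)"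
    using R a by (intro tendsto_intros) auto
  moreover have "einterval (ereal R) \<infinity> = {R<..}"
    by (auto simp: einterval_def)
  moreover have "((\<lambda>t. t powr (a + 1) / (a + 1)) has_real_derivative x powr a) (at x)" if "x > R" for x
    using that R a by (auto intro!: derivative_eq_intros)
  moreover have "isCont (\<lambda>t. t powr a) x" if "x > R" for x
    using that R by (intro continuous_intros) auto
  ultimately show ?thesis
    using interval_integral_FTC_nonneg(1)[of "ereal R" \<infinity> "\<lambda>t. t powr (a + 1) / (a + 1)" "\<lambda>t. t powr a"
        "R powr (a + 1) / (a + 1)" 0] lim
    by (simp add: ereal_tendsto_simps)
qed

text \<open>The quotient is bounded on a compact interval, and beyond it the quadratic growth of the
  denominator leaves a multiple of \<open>\<bar>t\<bar> powr (a - 2)\<close> with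
  \<open>a - 2 < -1\<close>.\<close>

lemma integrable_cauchy_of_growth:
  fixes h :: "real \<Rightarrow> complex"
  assumes alpha: "\<alpha> > 0" and cont: "continuous_on UNIV h"
    and growth: "\<forall>\<^sub>F t in at_infinity. norm (h t) \<le> C * \<bar>t\<bar> powr a" and a: "a < 1"
  shows "integrable lborel (\<lambda>t. h t / of_real (\<alpha>\<^sup>2 + (t - \<beta>)\<^sup>2))"
proof -
  let ?D = "\<lambda>t. h t / of_real (\<alpha>\<^sup>2 + (t - \<beta>)\<^sup>2)"
  have dpos: "\<alpha>\<^sup>2 + (t - \<beta>)\<^sup>2 > 0" for t
    using alpha by (simp add: add_pos_nonneg)
  have nz: "complex_of_real (\<alpha>\<^sup>2 + (t - \<beta>)\<^sup>2) \<noteq> 0" for t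
    using dpos[of t] by (metis less_irrefl of_real_eq_0_iff)
  have contD: "continuous_on UNIV ?D"
    using cont nz by (intro continuous_intros) auto
  obtain R0 where R0: "\<And>t. \<bar>t\<bar> \<ge> R0 \<Longrightarrow> norm (h t) \<le> C * \<bar>t\<bar> powr a"
    using growth by (auto simp: eventually_at_infinity)
  \<comment> \<open>Beyond \<open>2 * \<bar>\<beta>\<bar>\<close> one has
    \<open>\<bar>t - \<beta>\<bar> \<ge> \<bar>t\<bar> / 2\<close>, the source of the factor 4 in
    the tail bound.\<close>
  define R where "R = max R0 (2 * \<bar>\<beta>\<bar> + 1)"
  have R: "R > 0" "R \<ge> R0" "R \<ge> 2 * \<bar>\<beta>\<bar>"
    by (auto simp: R_def)
  have "bounded (?D ` {- R..R})"
    using contD continuous_on_subset by (intro compact_imp_bounded compact_continuous_image) blast+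
  then obtain B where "\<forall>y\<in>?D ` {- R..R}. norm y \<le> B"
    unfolding bounded_iff by blast
  then have B: "norm (?D t) \<le> B" if "t \<in> {- R..R}" for t
    using that by blast
  have B0: "B \<ge> 0"
    using B[of 0] R(1) norm_ge_zero[of "?D 0"] by (simp del: norm_ge_zero)
  define p where "p t = indicator {R<..} t * t powr (a - 2)" for t :: real
  have tail: "norm (?D t) \<le> 4 * \<bar>C\<bar> * \<bar>t\<bar> powr (a - 2)" if t: "\<bar>t\<bar> > R" for t
  proof -
    have "\<bar>t - \<beta>\<bar> \<ge> \<bar>t\<bar> / 2"
      using t R(3) by linarith
    then have "(\<bar>t\<bar> / 2)\<^sup>2 \<le> \<bar>t - \<beta>\<bar>\<^sup>2"
      by (intro power_mono) auto
    then have "t\<^sup>2 / 4 \<le> (t - \<beta>)\<^sup>2"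
      by (simp add: power_divide)
    also have "\<dots> \<le> \<alpha>\<^sup>2 + (t - \<beta>)\<^sup>2"
      by simp
    finally have d: "t\<^sup>2 / 4 \<le> \<alpha>\<^sup>2 + (t - \<beta>)\<^sup>2" .
    have t2: "t\<^sup>2 > 0"
      using t R(1) by auto
    have "norm (h t) \<le> C * \<bar>t\<bar> powr a"
      using R0 t R(2) by simp
    also have "\<dots> \<le> \<bar>C\<bar> * \<bar>t\<bar> powr a"
      by (intro mult_right_mono) auto
    finally have "norm (?D t) \<le> \<bar>C\<bar> * \<bar>t\<bar> powr a / (t\<^sup>2 / 4)"
      using d t2 dpos[of t] unfolding norm_divide norm_of_real by (intro frac_le) auto
    also have "\<bar>t\<bar> powr a = \<bar>t\<bar> powr (a - 2) * t\<^sup>2"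
      using t R(1) powr_add[of "\<bar>t\<bar>" "a - 2" 2] by simp
    finally show ?thesis
      using t2 by simp
  qed
  have int_p: "integrable lborel p"
    using set_integrable_powr_at_top[of "a - 2" R] a R(1) by (simp add: set_integrable_def p_def[abs_def])
  have "integrable lborel (\<lambda>t. p (- t))"
    using lborel_integrable_real_affine[OF int_p, of "-1" 0] by simp
  moreover have "integrable lborel (indicator {- R..R} :: real \<Rightarrow> real)"
    by (rule integrable_real_indicator) (auto simp: emeasure_lborel_Icc_eq)
  ultimately have "integrable lborel (\<lambda>t. B * indicator {- R..R} t + 4 * \<bar>C\<bar> * p t + 4 * \<bar>C\<bar> * p (- t))"
    using int_p by (intro Bochner_Integration.integrable_add integrable_mult_right) auto
  then show ?thesis
  proof (rule Bochner_Integration.integrable_bound)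
    show "?D \<in> borel_measurable lborel"
      using contD by (simp add: borel_measurable_continuous_onI)
    show "AE t in lborel. norm (?D t) \<le> norm (B * indicator {- R..R} t + 4 * \<bar>C\<bar> * p t + 4 * \<bar>C\<bar> * p (- t))"
    proof (rule AE_I2)
      fix t
      consider "t \<in> {- R..R}" | "t > R" | "t < - R"
        by fastforce
      then have "norm (?D t) \<le> B * indicator {- R..R} t + 4 * \<bar>C\<bar> * p t + 4 * \<bar>C\<bar> * p (- t)"
      proof cases
        case 1
        then show ?thesis
          using B by (simp add: p_def)
      next
        case 2
        then show ?thesis
          using tail[of t] R(1) by (simp add: p_def)
      next
        case 3
        then show ?thesis
          using tail[of t] R(1) by (simp add: p_def)
      qed
      then show "norm (?D t) \<le> norm (B * indicator {- R..R} t + 4 * \<bar>C\<bar> * p t + 4 * \<bar>C\<bar> * p (- t))"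
        by simp
    qed
  qed
qed

text \<open>Integrability is a separate conjunct because the integral of a non-integrable function
  is 0 by default. In the growth condition \<open>C\<close> depends on \<open>\<epsilon>\<close>
  only, while the threshold for \<open>t\<close> may vary with \<open>\<sigma>\<close>.\<close>

theorem theorem7p2:
  fixes \<alpha> \<beta> c \<sigma>0 t0 :: real
    and m :: nat
    and f :: "complex \<Rightarrow> complex"
    and n k :: "nat \<Rightarrow> nat"
  assumes alpha: "\<alpha> > 0"
    and mero: "meromorphic_function_on f (right_halfplane c)"
    and bounded: "\<exists>K>0. \<exists>c'>c. \<forall>\<sigma>>c'. \<forall>t. cmod (f (Complex \<sigma> t)) \<le> K"
    and growth: "\<exists>\<nu> :: real \<Rightarrow> real. antimono_on {c<..} \<nu> \<and>
        (\<forall>\<^sub>F \<sigma> in at_right c. \<nu> \<sigma> \<le> 1 + c - \<sigma>) \<and>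
        (\<forall>\<epsilon>>0. \<exists>C. \<forall>\<sigma>>c. \<forall>\<^sub>F t in at_infinity.
            cmod (f (Complex \<sigma> t)) \<le> C * \<bar>t\<bar> powr (\<nu> \<sigma> + \<epsilon>))"
    and poles: "poles_in (right_halfplane c) f = {} \<and> m = 0 \<or>
        poles_in (right_halfplane c) f = {Complex \<sigma>0 t0} \<and>
          m \<ge> 1 \<and> zorder f (Complex \<sigma>0 t0) = - int m"
    and stoltz: "stoltz n k"
  shows "\<forall>s \<in> right_halfplane c.
      (poles_in (right_halfplane c) f \<noteq> {} \<longrightarrow> Re s \<noteq> \<sigma>0) \<longrightarrow>
        integrable lborel (\<lambda>\<tau>. f (s + \<i> * of_real \<tau>) / of_real (\<alpha>\<^sup>2 + (\<tau> - \<beta>)\<^sup>2)) \<and>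
        (AE x in lborel.
          (\<lambda>l. 1 / of_nat (k l) *
               (\<Sum>j = 1..k l. f (s + \<i> * of_real ((boole_map \<alpha> \<beta> ^^ (n l + j)) x))))
          \<longlonglongrightarrow> of_real (\<alpha> / pi) *
               (LINT \<tau>|lborel. f (s + \<i> * of_real \<tau>) / of_real (\<alpha>\<^sup>2 + (\<tau> - \<beta>)\<^sup>2)))"
proof (intro ballI impI)
  fix s
  assume s: "s \<in> right_halfplane c" and off: "poles_in (right_halfplane c) f \<noteq> {} \<longrightarrow> Re s \<noteq> \<sigma>0"
  obtain \<nu> :: "real \<Rightarrow> real" where anti: "antimono_on {c<..} \<nu>"
    and near: "\<forall>\<^sub>F \<sigma> in at_right c. \<nu> \<sigma> \<le> 1 + c - \<sigma>"
    and gr: "\<forall>\<epsilon>>0. \<exists>C. \<forall>\<sigma>>c. \<forall>\<^sub>F t in at_infinity.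
            cmod (f (Complex \<sigma> t)) \<le> C * \<bar>t\<bar> powr (\<nu> \<sigma> + \<epsilon>)"
    using growth by blast
  have sc: "Re s > c"
    using s by (simp add: right_halfplane_def)
  \<comment> \<open>Close to \<open>c\<close> the exponent is at most \<open>1 + c - y < 1\<close>,
    and monotonicity carries this bound to the right up to \<open>Re s\<close>. The witness
    \<open>y\<close> is the midpoint between \<open>c\<close> and
    \<open>min b (Re s)\<close>.\<close>
  have "\<nu> (Re s) < 1"
  proof -
    obtain b where b: "b > c" "\<And>y. y > c \<Longrightarrow> y < b \<Longrightarrow> \<nu> y \<le> 1 + c - y"
      using near by (auto simp: eventually_at_right_field)
    define y where "y = (c + min b (Re s)) / 2"
    have y: "c < y" "y < b" "y < Re s"
      using b(1) sc by (auto simp: y_def min_def)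
    have "\<nu> (Re s) \<le> \<nu> y"
      using anti y sc by (auto simp: monotone_on_def)
    also have "\<dots> < 1"
      using b(2)[of y] y by simp
    finally show ?thesis .
  qed
  define \<epsilon> where "\<epsilon> = (1 - \<nu> (Re s)) / 2"
  have \<epsilon>: "\<epsilon> > 0" "\<nu> (Re s) + \<epsilon> < 1"
    using \<open>\<nu> (Re s) < 1\<close> by (auto simp: \<epsilon>_def field_simps)
  obtain C where C: "\<forall>\<^sub>F t in at_infinity. cmod (f (Complex (Re s) t)) \<le> C * \<bar>t\<bar> powr (\<nu> (Re s) + \<epsilon>)"
    using gr \<epsilon>(1) sc by blast
  have "f holomorphic_on (right_halfplane c - poles_in (right_halfplane c) f)"
    using mero by (simp add: meromorphic_function_on_def)
  then have contf: "continuous_on (right_halfplane c - poles_in (right_halfplane c) f) f"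
    by (rule holomorphic_on_imp_continuous_on)
  have "Complex (Re s) t \<in> right_halfplane c" for t
    using sc by (simp add: right_halfplane_def)
  \<comment> \<open>A pole would have real part \<open>\<sigma>0\<close>, which differs from
    \<open>Re s\<close>, so \<open>f\<close> is continuous along the whole line.\<close>
  moreover have "Complex (Re s) t \<notin> poles_in (right_halfplane c) f" for t
    using off poles by auto
  ultimately have line: "range (Complex (Re s)) \<subseteq> right_halfplane c - poles_in (right_halfplane c) f"
    by blast
  have "continuous_on UNIV (Complex (Re s))"
    unfolding Complex_eq by (intro continuous_intros)
  then have cont: "continuous_on UNIV (\<lambda>t. f (Complex (Re s) t))"
    by (rule continuous_on_compose2[OF contf _ line])
  have eq: "s + \<i> * of_real \<tau> = Complex (Re s) (Im s + \<tau>)" for \<tau>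
    by (simp add: complex_eq_iff)
  \<comment> \<open>The growth bound concerns the height \<open>t = Im s + \<tau>\<close>, so the
    kernel is first centred at \<open>\<beta> + Im s\<close> and then translated back.\<close>
  have "integrable lborel (\<lambda>t. f (Complex (Re s) t) / of_real (\<alpha>\<^sup>2 + (t - (\<beta> + Im s))\<^sup>2))"
    by (rule integrable_cauchy_of_growth[OF alpha cont C \<epsilon>(2)])
  from lborel_integrable_real_affine[OF this, of 1 "Im s"]
  have int: "integrable lborel (\<lambda>\<tau>. f (s + \<i> * of_real \<tau>) / of_real (\<alpha>\<^sup>2 + (\<tau> - \<beta>)\<^sup>2))"
    by (simp add: eq algebra_simps)
  have "continuous_on UNIV (\<lambda>\<tau>. f (s + \<i> * of_real \<tau>))"
    unfolding eq by (rule continuous_on_compose2[OF cont]) (auto intro!: continuous_intros)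
  from int moving_averages_boole[OF alpha stoltz this int]
  show "integrable lborel (\<lambda>\<tau>. f (s + \<i> * of_real \<tau>) / of_real (\<alpha>\<^sup>2 + (\<tau> - \<beta>)\<^sup>2)) \<and>
        (AE x in lborel.
          (\<lambda>l. 1 / of_nat (k l) *
               (\<Sum>j = 1..k l. f (s + \<i> * of_real ((boole_map \<alpha> \<beta> ^^ (n l + j)) x))))
          \<longlonglongrightarrow> of_real (\<alpha> / pi) *
               (LINT \<tau>|lborel. f (s + \<i> * of_real \<tau>) / of_real (\<alpha>\<^sup>2 + (\<tau> - \<beta>)\<^sup>2)))" ..
qed

end
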